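(* Let $(\mathcal{H},X,G,k,\mu,d)$ be a Berezin quantization. Suppose that the continuous Parseval frame $\{k_x\}_{x\in X}$ satisfies the following: there exist a (measurable) weight $w:X\to(0,\infty)$ and $M>0$ such that (i) $\displaystyle w(y)^{-1}\int_X |\langle k_x,k_y\rangle|\, w(x)\,d\mu(x)\le M$ for all $y\in X$; (ii) $\displaystyle \lim_{R\to\infty}\sup_{y\in X} w(y)^{-1}\int_{B(y,R)^c}|\langle k_x,k_y\rangle|\, w(x)\,d\mu(x)=0$; (iii) $|\langle k_x,k_y\rangle|\to 0$ as $d(x,y)\to\infty$. Let $\sigma\in L^\infty(X)$ be non-negative. Then $\sigma$ is thin if and only if the Toeplitz operator $T_\sigma:\mathcal{H}\to\mathcal{H}$ is compact.
   Context: A Berezin quantization $(\mathcal{H},X,G,k,\mu,d)$ consists of the following. $\mathcal{H}$ is a Hilbert space. $(X,d,\mu)$ is a metric measure space with metric $d$ and Borel measure $\mu$, where $d$ is proper (every ball is precompact). $k:X\to\mathcal{H}$, $x\mapsto k_x$, is a continuous map such that $\{k_x\}_{x\in X}$ is a continuous Parseval frame: $f=\int_X\langle f,k_x\rangle k_x\,d\mu(x)$ (weakly) for every $f\in\mathcal{H}$. $G$ is a locally compact group acting transitively on $X$ so that $\mu(gE)=\mu(E)$, $d(gx,gy)=d(x,y)$ and $|\langle k_{gx},k_{gy}\rangle|=|\langle k_x,k_y\rangle|$ for all $g\in G$, $x,y\in X$ and measurable $E\subset X$. $B(y,R)$ is the ball of radius $R$ about $y$ for $d$. For a bounded measurable $\sigma\geq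 0$, the Toeplitz operator is $T_\sigma f=\int_X\sigma(x)\langle f,k_x\rangle k_x\,d\mu(x)$ (weak integral). The notation $y\to\infty$ means $d(z,y)\to\infty$ for some (equivalently all) $z\in X$. A function $\sigma$ is thin if its Berezin transform $\tilde\sigma(y)=\langle T_\sigma k_y,k_y\rangle=\int_X\sigma(x)|\langle k_x,k_y\rangle|^2\,d\mu(x)$ tends to $0$ as $y\to\infty$. *)

theory Defs
  imports "HOL-Analysis.Analysis" "HOL-Algebra.Group_Action"
begin

section \<open>Complex Hilbert spaces\<close>

text \<open>The inner product is linear in the first and conjugate-linear in the second argument.\<close>

class complex_inner = real_normed_vector +
  fixes scaleC :: "complex \<Rightarrow> 'a \<Rightarrow> 'a"  (infixr \<open>*\<^sub>C\<close> 75)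
    and cinner :: "'a \<Rightarrow> 'a \<Rightarrow> complex"
  assumes scaleC_add_right: "c *\<^sub>C (x + y) = c *\<^sub>C x + c *\<^sub>C y"
    and scaleC_add_left: "(b + c) *\<^sub>C x = b *\<^sub>C x + c *\<^sub>C x"
    and scaleC_scaleC: "b *\<^sub>C c *\<^sub>C x = (b * c) *\<^sub>C x"
    and scaleR_scaleC: "r *\<^sub>R x = complex_of_real r *\<^sub>C x"
    and cinner_commute: "cinner x y = cnj (cinner y x)"
    and cinner_add_left: "cinner (x + y) z = cinner x z + cinner y z"
    and cinner_scaleC_left: "cinner (c *\<^sub>C x) y = c * cinner x y"
    and cinner_self_nonneg: "0 \<le> Re (cinner x x)"
    and cinner_self_eq_0_iff: "cinner x x = 0 \<longleftrightarrow> x = 0"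
    and norm_eq_sqrt_cinner: "norm x = sqrt (Re (cinner x x))"

class chilbert_space = complex_inner + complete_space
begin

subclass banach ..

end

instantiation complex :: chilbert_space
begin

definition scaleC_complex :: "complex \<Rightarrow> complex \<Rightarrow> complex"
  where "scaleC_complex c x = c * x"

definition cinner_complex :: "complex \<Rightarrow> complex \<Rightarrow> complex"
  where "cinner_complex x y = x * cnj y"

instance
  by standard
    (auto simp: scaleC_complex_def cinner_complex_def algebra_simps scaleR_conv_of_real
      cmod_def power2_eq_square)

end

text \<open>Weak integrals: \<open>v = \<integral> F d\<mu>\<close> means \<open>\<langle>v, g\<rangle> = \<integral> \<langle>F x, g\<rangle> d\<mu>(x)\<close> for all \<open>g\<close>.
  Integrability is required explicitly because \<^const>\<open>lebesgue_integral\<close> is \<open>0\<close> on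
  non-integrable functions.\<close>

definition has_weak_integral ::
    "'x measure \<Rightarrow> ('x \<Rightarrow> 'h::chilbert_space) \<Rightarrow> 'h \<Rightarrow> bool"
  where "has_weak_integral \<mu> F v \<longleftrightarrow>
    (\<forall>g. integrable \<mu> (\<lambda>x. cinner (F x) g) \<and> (\<integral>x. cinner (F x) g \<partial>\<mu>) = cinner v g)"

definition compact_operator :: "('h::chilbert_space \<Rightarrow> 'h) \<Rightarrow> bool"
  where "compact_operator T \<longleftrightarrow>
    Vector_Spaces.linear scaleC scaleC T \<and> (\<forall>B. bounded B \<longrightarrow> compact (closure (T ` B)))"


section \<open>Berezin quantizations\<close>

locale locally_compact_group = group G
  for G :: "('g, 'm) monoid_scheme" (structure) +
  fixes T :: "'g topology"
  assumes topspace_eq: "topspace T = carrier G"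
    and continuous_mult: "continuous_map (prod_topology T T) T (\<lambda>(g, h). g \<otimes> h)"
    and continuous_inv: "continuous_map T T (\<lambda>g. inv g)"
    and locally_compact: "locally_compact_space T"
    and Hausdorff: "Hausdorff_space T"

definition continuous_parseval_frame :: "'x::metric_space measure \<Rightarrow> ('x \<Rightarrow> 'h::chilbert_space) \<Rightarrow> bool"
  where "continuous_parseval_frame \<mu> k \<longleftrightarrow>
    continuous_on UNIV k \<and> (\<forall>f. has_weak_integral \<mu> (\<lambda>x. cinner f (k x) *\<^sub>C k x) f)"

text \<open>The space \<open>X\<close> is the type \<open>'x\<close> with metric \<^const>\<open>dist\<close>, the Hilbert space is the type \<open>'h\<close>,
  and \<open>g \<in> carrier G\<close> acts on \<open>X\<close> by \<open>\<phi> g\<close>.\<close>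

locale berezin_quantization =
  locally_compact_group G T + transitive_action G "UNIV :: 'x::metric_space set" \<phi>
  for G :: "('g, 'm) monoid_scheme" (structure) and T :: "'g topology"
    and \<phi> :: "'g \<Rightarrow> 'x::metric_space \<Rightarrow> 'x" +
  fixes \<mu> :: "'x::metric_space measure" and k :: "'x::metric_space \<Rightarrow> 'h::chilbert_space"
  assumes proper: "compact (closure (ball (x :: 'x::metric_space) r))"
    and sets_eq_borel: "sets \<mu> = sets borel"
    and parseval: "continuous_parseval_frame \<mu> k"
    and measure_invariant: "g \<in> carrier G \<Longrightarrow> E \<in> sets \<mu> \<Longrightarrow> emeasure \<mu> (\<phi> g ` E) = emeasure \<mu> E"
    and dist_invariant: "g \<in> carrier G \<Longrightarrow> dist (\<phi> g x) (\<phi> g y) = dist x y"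
    and kernel_invariant: "g \<in> carrier G \<Longrightarrow>
      cmod (cinner (k (\<phi> g x)) (k (\<phi> g y))) = cmod (cinner (k x) (k y))"


section \<open>Toeplitz operators and thin functions\<close>

text \<open>Real \<open>L\<^sup>\<infinity>\<close>, given by representatives: measurable, essentially bounded functions.\<close>

definition Linfty :: "'x measure \<Rightarrow> ('x \<Rightarrow> real) set"
  where "Linfty \<mu> = {\<sigma> \<in> borel_measurable \<mu>. \<exists>C. AE x in \<mu>. \<bar>\<sigma> x\<bar> \<le> C}"

definition toeplitz ::
    "'x measure \<Rightarrow> ('x \<Rightarrow> 'h::chilbert_space) \<Rightarrow> ('x \<Rightarrow> real) \<Rightarrow> 'h \<Rightarrow> 'h"
  where "toeplitz \<mu> k \<sigma> f =
    (THE v. has_weak_integral \<mu> (\<lambda>x. \<sigma> x *\<^sub>R cinner f (k x) *\<^sub>C k x) v)"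

definition berezin_transform ::
    "'x measure \<Rightarrow> ('x \<Rightarrow> 'h::chilbert_space) \<Rightarrow> ('x \<Rightarrow> real) \<Rightarrow> 'x \<Rightarrow> complex"
  where "berezin_transform \<mu> k \<sigma> y = cinner (toeplitz \<mu> k \<sigma> (k y)) (k y)"

text \<open>The filter \<open>filtercomap (dist z) at_top\<close> expresses \<open>y \<rightarrow> \<infinity>\<close>, that is \<open>dist z y \<rightarrow> \<infinity>\<close>;
  it does not depend on \<open>z\<close>.\<close>

lemma filtercomap_dist_at_top_eq:
  fixes z z' :: "'x::metric_space"
  shows "filtercomap (dist z) at_top = filtercomap (dist z') at_top"
proof -
  have *: "filtercomap (dist a) at_top \<le> filtercomap (dist b) at_top" for a b :: 'x
  proof -
    have "filterlim (\<lambda>y. - dist a b + dist a y) at_top (filtercomap (dist a) at_top)"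
      by (intro filterlim_tendsto_add_at_top[OF tendsto_const] filterlim_filtercomap)
    moreover have "- dist a b + dist a y \<le> dist b y" for y
      by (metis add.commute diff_le_eq dist_triangle uminus_add_conv_diff)
    ultimately have "filterlim (dist b) at_top (filtercomap (dist a) at_top)"
      by (auto intro: filterlim_at_top_mono)
    then show ?thesis
      by (simp add: filterlim_iff_le_filtercomap)
  qed
  show ?thesis
    by (intro antisym *)
qed

definition thin ::
    "'x::metric_space measure \<Rightarrow> ('x \<Rightarrow> 'h::chilbert_space) \<Rightarrow> ('x \<Rightarrow> real) \<Rightarrow> bool"
  where "thin \<mu> k \<sigma> \<longleftrightarrow>
    (\<exists>z. (berezin_transform \<mu> k \<sigma> \<longlongrightarrow> 0) (filtercomap (dist z) at_top))"

lemma thin_iff: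
  "thin \<mu> k \<sigma> \<longleftrightarrow> (berezin_transform \<mu> k \<sigma> \<longlongrightarrow> 0) (filtercomap (dist z) at_top)"
  unfolding thin_def using filtercomap_dist_at_top_eq by metis

end

theory Submission
  imports Defs
begin

text \<open>For a bounded symbol \<open>s \<ge> 0\<close>, the form \<open>\<langle>T\<^sub>s f, g\<rangle>\<close> is \<open>\<integral>s(x) \<langle>f, k\<^sub>x\<rangle> \<langle>k\<^sub>x, g\<rangle> d\<mu>(x)\<close>.

  If \<open>T\<^sub>\<sigma>\<close> is compact: by (iii) the vectors \<open>k\<^sub>y\<close> tend weakly to \<open>0\<close> as \<open>y \<rightarrow> \<infinity>\<close>, hence
  \<open>T\<^sub>\<sigma> k\<^sub>y \<rightarrow> 0\<close> in norm, and \<open>\<sigma>\<close> is thin because \<open>\<parallel>k\<^sub>y\<parallel>\<close> is constant.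

  If \<open>\<sigma>\<close> is thin: cut \<open>\<sigma>\<close> off at a large ball \<open>B(z, r)\<close>. The inner part gives a compact operator,
  since \<open>k\<close> is uniformly approximable by finitely many vectors on a relatively compact set. For the
  outer part \<open>s\<close>, one has \<open>\<parallel>T\<^sub>s f\<parallel>\<^sup>2 \<le> \<Lambda> \<langle>T\<^sub>s f, f\<rangle>\<close> with \<open>\<Lambda>\<close> a Schur bound for the kernel
  \<open>|\<langle>k\<^sub>x, k\<^sub>y\<rangle>|\<close> with respect to \<open>s d\<mu>\<close>. The kernel is split at \<open>d(x, y) = R\<close>. The far part is small
  by (ii). For the near part, \<open>|\<langle>k\<^sub>x, k\<^sub>y\<rangle>|\<close> is bounded below near the diagonal, uniformly by
  transitivity, so thinness makes the integrals of \<open>s\<close> over all balls of radius \<open>R\<close> uniformly small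
  when \<open>r\<close> is large.\<close>

section \<open>Complex inner product spaces\<close>

lemma cinner_add_right: "cinner x (y + z) = cinner x y + cinner (x::'a::complex_inner) z"
  by (metis cinner_add_left cinner_commute complex_cnj_add)

lemma cinner_scaleC_right: "cinner x (c *\<^sub>C y) = cnj c * cinner (x::'a::complex_inner) y"
  by (metis cinner_commute cinner_scaleC_left complex_cnj_mult)

lemma cinner_self: "cinner x x = complex_of_real ((norm (x::'a::complex_inner))\<^sup>2)"
proof -
  have "Im (cinner x x) = 0"
    by (metis cinner_commute complex_cnj_cnj Reals_cnj_iff complex_is_Real_iff)
  then show ?thesis
    by (simp add: complex_eq_iff norm_eq_sqrt_cinner cinner_self_nonneg)
qed

lemma norm_scaleC [simp]: "norm (c *\<^sub>C (x::'a::complex_inner)) = cmod c * norm x"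
proof -
  have "complex_of_real ((norm (c *\<^sub>C x))\<^sup>2) = c * cnj c * complex_of_real ((norm x)\<^sup>2)"
    unfolding cinner_self [symmetric] by (simp add: cinner_scaleC_left cinner_scaleC_right)
  also have "\<dots> = complex_of_real ((cmod c * norm x)\<^sup>2)"
    by (simp add: complex_norm_square [symmetric] power_mult_distrib)
  finally have "(norm (c *\<^sub>C x))\<^sup>2 = (cmod c * norm x)\<^sup>2"
    using of_real_eq_iff by blast
  then show ?thesis
    by (simp add: power2_eq_iff_nonneg)
qed

lemma cinner_scaleR_left: "cinner (r *\<^sub>R x) y = r *\<^sub>R cinner (x::'a::complex_inner) y"
  by (simp add: scaleR_scaleC cinner_scaleC_left scaleC_complex_def)

lemma cinner_scaleR_right: "cinner x (r *\<^sub>R y) = r *\<^sub>R cinner (x::'a::complex_inner) y"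
  by (simp add: scaleR_scaleC cinner_scaleC_right scaleC_complex_def)

lemma cmod_cinner_commute: "cmod (cinner x y) = cmod (cinner y (x::'a::complex_inner))"
  by (metis cinner_commute complex_mod_cnj)

lemma cinner_Cauchy_Schwarz: "cmod (cinner x y) \<le> norm x * norm (y::'a::complex_inner)"
proof (cases "y = 0")
  case True
  have "cinner x 0 = 0"
    using cinner_add_right [of x 0 0] by simp
  then show ?thesis
    using True by simp
next
  case False
  define z where "z = cinner x y"
  \<comment> \<open>\<open>a\<close> is \<open>(norm y)^2\<close> times the component of
    \<open>x\<close> orthogonal to \<open>y\<close>. Scaling up avoids a division, and
    \<open>norm a \<ge> 0\<close> becomes the claim after cancelling
    \<open>(norm y)^2\<close>.\<close>
  define a where "a = (norm y)\<^sup>2 *\<^sub>R x + (- z) *\<^sub>C y"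
  have "complex_of_real ((norm a)\<^sup>2) = cinner a a"
    by (rule cinner_self [symmetric])
  also have "\<dots> = complex_of_real ((norm y)\<^sup>2) * (complex_of_real ((norm y)\<^sup>2 * (norm x)\<^sup>2) - z * cnj z)"
    unfolding a_def cinner_add_left cinner_add_right cinner_scaleR_left cinner_scaleR_right
      cinner_scaleC_left cinner_scaleC_right
    unfolding cinner_self z_def [symmetric] cinner_commute [of y x]
    by (simp add: scaleR_conv_of_real algebra_simps)
  also have "\<dots> = complex_of_real ((norm y)\<^sup>2 * ((norm y)\<^sup>2 * (norm x)\<^sup>2 - (cmod z)\<^sup>2))"
    by (simp add: complex_norm_square [symmetric])
  finally have "(norm a)\<^sup>2 = (norm y)\<^sup>2 * ((norm y)\<^sup>2 * (norm x)\<^sup>2 - (cmod z)\<^sup>2)"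
    using of_real_eq_iff by blast
  then have "0 \<le> (norm y)\<^sup>2 * ((norm y)\<^sup>2 * (norm x)\<^sup>2 - (cmod z)\<^sup>2)"
    by (metis zero_le_power2)
  then have "(cmod z)\<^sup>2 \<le> (norm x * norm y)\<^sup>2"
    using False by (simp add: zero_le_mult_iff power_mult_distrib mult.commute)
  then show ?thesis
    unfolding z_def by (rule power2_le_imp_le) simp
qed

lemma bounded_bilinear_cinner: "bounded_bilinear (cinner :: 'a::complex_inner \<Rightarrow> _)"
proof
  show "\<exists>K. \<forall>x y::'a. norm (cinner x y) \<le> norm x * norm y * K"
    using cinner_Cauchy_Schwarz by (intro exI[of _ 1]) auto
qed (rule cinner_add_left cinner_add_right cinner_scaleR_left cinner_scaleR_right)+

interpretation cinner: bounded_bilinear "cinner :: 'a::complex_inner \<Rightarrow> 'a \<Rightarrow> complex"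
  by (rule bounded_bilinear_cinner)

lemma vector_space_scaleC: "vector_space (scaleC :: complex \<Rightarrow> 'a::complex_inner \<Rightarrow> 'a)"
proof
  show "1 *\<^sub>C x = (x::'a)" for x
    using scaleR_scaleC [of 1 x] by simp
qed (rule scaleC_add_right scaleC_add_left scaleC_scaleC)+

lemma linear_scaleC_iff:
  "Vector_Spaces.linear scaleC scaleC (f :: 'a::complex_inner \<Rightarrow> 'b::complex_inner) \<longleftrightarrow>
    (\<forall>x y. f (x + y) = f x + f y) \<and> (\<forall>c x. f (c *\<^sub>C x) = c *\<^sub>C f x)"
  using vector_space_scaleC [where 'a='a] vector_space_scaleC [where 'a='b]
  by (simp add: Vector_Spaces.linear_def module_hom_def module_hom_axioms_def
      module_iff_vector_space)

lemma cinner_eqI: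
  fixes u v :: "'a::complex_inner"
  assumes "\<And>g. cinner u g = cinner v g"
  shows "u = v"
proof -
  have "cinner (u - v) (u - v) = 0"
    using assms by (simp add: cinner.diff_left)
  then show ?thesis
    by (simp add: cinner_self_eq_0_iff)
qed

lemma norm_add_square:
  "(norm (x + y))\<^sup>2 = (norm x)\<^sup>2 + 2 * Re (cinner x y) + (norm (y::'a::complex_inner))\<^sup>2"
proof -
  have *: "(norm u)\<^sup>2 = Re (cinner u u)" for u :: 'a
    by (simp add: cinner_self)
  show ?thesis
    unfolding * cinner_add_left cinner_add_right using cinner_commute [of y x] by simp
qed

text \<open>The representing vector minimises \<open>\<parallel>v\<parallel>\<^sup>2 - 2 Re F v\<close>; minimising sequences are Cauchy
  by the parallelogram law.\<close>

lemma Riesz_representation: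
  fixes F :: "'h::chilbert_space \<Rightarrow> complex"
  assumes add: "\<And>x y. F (x + y) = F x + F y" and scale: "\<And>c x. F (c *\<^sub>C x) = c * F x"
    and bound: "\<And>x. cmod (F x) \<le> B * norm x"
  obtains v where "\<And>g. F g = cinner g v"
proof -
  have scaleR: "F (r *\<^sub>R x) = r *\<^sub>R F x" for r x
    by (simp add: scaleR_scaleC scale scaleC_complex_def)
  have "bounded_linear F"
    using bound by (intro bounded_linear_intro[of _ B] add scaleR) (simp add: mult.commute)
  then interpret F: bounded_linear F .
  define J where "J v = (norm v)\<^sup>2 - 2 * Re (F v)" for v
  have lower: "- B\<^sup>2 \<le> J v" for v
  proof -
    have "Re (F v) \<le> B * norm v"
      using bound complex_Re_le_cmod order_trans by blast
    \<comment> \<open>Completing the square: \<open>J v\<close> is at least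
      \<open>(norm v - B)^2 - B^2\<close>.\<close>
    moreover have "0 \<le> (norm v - B)\<^sup>2"
      by simp
    ultimately show ?thesis
      by (simp add: J_def power2_diff algebra_simps)
  qed
  define m where "m = Inf (range J)"
  have bdd: "bdd_below (range J)"
    using lower by (rule bdd_belowI2)
  have m_le: "m \<le> J v" for v
    unfolding m_def by (rule cInf_lower) (use bdd in auto)
  have "\<exists>v. J v < m + inverse (Suc n)" for n :: nat
    using cInf_lessD [of "range J" "m + inverse (Suc n)"] by (auto simp: m_def)
  then obtain v where v: "\<And>n. J (v n) < m + inverse (Suc n)"
    by metis
  have parallelogram: "(norm (x - y))\<^sup>2 \<le> 2 * (J x - m) + 2 * (J y - m)" for x y
  proof -
    have "(norm (x - y))\<^sup>2 + (norm (x + y))\<^sup>2 = 2 * (norm x)\<^sup>2 + 2 * (norm y)\<^sup>2"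
      using norm_add_square [of x "- y"] norm_add_square [of x y] by (simp add: cinner.minus_right)
    moreover have "norm ((1/2) *\<^sub>R (x + y)) = norm (x + y) / 2"
      by simp
    then have "4 * J ((1/2) *\<^sub>R (x + y)) = (norm (x + y))\<^sup>2 - 4 * Re (F x + F y)"
      by (simp only: J_def scaleR add) (simp add: power_divide field_simps)
    moreover have "4 * m \<le> 4 * J ((1/2) *\<^sub>R (x + y))"
      using m_le by simp
    ultimately show ?thesis
      by (simp add: J_def algebra_simps)
  qed
  have "Cauchy v"
  proof (rule metric_CauchyI)
    fix e :: real assume "e > 0"
    \<comment> \<open>Each defect \<open>J (v n) - m\<close> below \<open>e^2 / 4\<close> enters
      \<open>parallelogram\<close> with factor 2, and there are two of them, so the total stays
      below \<open>e^2\<close>.\<close>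
    then obtain N :: nat where N: "inverse (Suc N) < e\<^sup>2 / 4"
      using reals_Archimedean [of "e\<^sup>2 / 4"] by auto
    have small: "J (v n) - m < e\<^sup>2 / 4" if "N \<le> n" for n
    proof -
      have "inverse (real (Suc n)) \<le> inverse (Suc N)"
        using that by simp
      then show ?thesis
        using v [of n] N by linarith
    qed
    have "dist (v i) (v j) < e" if "N \<le> i" "N \<le> j" for i j
    proof -
      have "(norm (v i - v j))\<^sup>2 < e\<^sup>2"
        using parallelogram [of "v i" "v j"] small [OF that(1)] small [OF that(2)] by simp
      then show ?thesis
        using \<open>e > 0\<close> by (simp add: dist_norm power_less_imp_less_base)
    qed
    then show "\<exists>N. \<forall>i\<ge>N. \<forall>j\<ge>N. dist (v i) (v j) < e"
      by blast
  qed
  then obtain a where a: "v \<longlonglongrightarrow> a"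
    using Cauchy_convergent convergent_def by blast
  have "J a \<le> m"
  proof (rule LIMSEQ_le)
    show "(\<lambda>n. J (v n)) \<longlonglongrightarrow> J a"
      unfolding J_def by (intro tendsto_intros F.tendsto a)
    show "(\<lambda>n. m + inverse (Suc n)) \<longlonglongrightarrow> m"
      using tendsto_add[OF tendsto_const LIMSEQ_inverse_real_of_nat] by simp
    show "\<exists>N. \<forall>n\<ge>N. J (v n) \<le> m + inverse (Suc n)"
      using v less_imp_le by blast
  qed
  have Re: "Re (F g) = Re (cinner g a)" for g
  proof -
    \<comment> \<open>First variation at the minimiser:
      \<open>J (a + t g) = J a + 2 t b + t^2 |g|^2\<close>, so minimality for all real
      \<open>t\<close> has to force \<open>b = 0\<close>.\<close>
    define b where "b = Re (cinner g a) - Re (F g)"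
    have "0 \<le> 2 * t * b + t\<^sup>2 * (norm g)\<^sup>2" for t
    proof -
      have "J a \<le> J (t *\<^sub>R g + a)"
        using m_le [of "t *\<^sub>R g + a"] \<open>J a \<le> m\<close> by linarith
      also have "\<dots> = J a + (2 * t * b + t\<^sup>2 * (norm g)\<^sup>2)"
        unfolding J_def norm_add_square add scaleR cinner_scaleR_left b_def
        by (simp add: power_mult_distrib algebra_simps)
      finally show ?thesis
        by simp
    qed
    note nonneg = this
    \<comment> \<open>The step \<open>t = - b / D\<close> makes the quadratic negative unless
      \<open>b = 0\<close>. The summand 1 keeps \<open>D\<close> positive when
      \<open>g = 0\<close>.\<close>
    define D where "D = (norm g)\<^sup>2 + 1"
    define t where "t = - b / D"
    have "D > 0"
      by (simp add: D_def add_nonneg_pos)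
    then have tD: "t * D = - b"
      by (simp add: t_def)
    have "0 \<le> (2 * t * b + t\<^sup>2 * (norm g)\<^sup>2) * D\<^sup>2"
      by (intro mult_nonneg_nonneg nonneg) simp
    also have "\<dots> = 2 * (t * D) * b * D + (t * D)\<^sup>2 * (norm g)\<^sup>2"
      by (simp add: power2_eq_square algebra_simps)
    also have "\<dots> = - (b\<^sup>2 * (D + 1))"
      unfolding tD by (simp add: D_def power2_eq_square algebra_simps)
    finally have "b\<^sup>2 * (D + 1) \<le> 0"
      by simp
    then have "b = 0"
      using \<open>D > 0\<close> by (simp add: mult_le_0_iff)
    then show ?thesis
      by (simp add: b_def)
  qed
  have "F g = cinner g a" for g
  proof (rule complex_eqI)
    show "Im (F g) = Im (cinner g a)"
      \<comment> \<open>Imaginary parts follow from real parts at \<open>\<i> g\<close>, since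
        \<open>Re (\<i> z) = - Im z\<close>.\<close>
      using Re [of "\<i> *\<^sub>C g"] by (simp add: scale cinner_scaleC_left)
  qed (rule Re)
  then show thesis ..
qed

section \<open>Measurability on products and the Schur test\<close>

text \<open>A Caratheodory function is a pointwise limit of maps
  \<open>f (p n (\<iota> n x)) y\<close>, where \<open>p n (\<iota> n x)\<close> is a point of a
  countable net close to \<open>x\<close>. Each such map is glued from countably many functions of
  \<open>y\<close> alone along measurable pieces in \<open>x\<close>. The nets express separability,
  which the sort \<open>metric_space\<close> does not include.\<close>

lemma measurable_pair_if_continuous_fst:
  fixes f :: "'x::metric_space \<Rightarrow> 'y \<Rightarrow> real"
  assumes sets: "sets M = sets borel"
    and nets: "\<And>e. e > 0 \<Longrightarrow> \<exists>D::'x set. countable D \<and> (\<forall>x. \<exists>p\<in>D. dist x p < e)"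
    and cont: "\<And>y. continuous_on UNIV (\<lambda>x. f x y)"
    and meas: "\<And>x. f x \<in> borel_measurable N"
  shows "(\<lambda>(x, y). f x y) \<in> borel_measurable (M \<Otimes>\<^sub>M N)"
proof -
  have "\<exists>p :: nat \<Rightarrow> 'x. \<forall>x. \<exists>i. dist x (p i) < inverse (Suc n)" for n :: nat
  proof -
    obtain D :: "'x set" where D: "countable D" "\<And>x. \<exists>p\<in>D. dist x p < inverse (Suc n)"
      using nets [of "inverse (Suc n)"] by auto
    then have "D \<noteq> {}"
      by blast
    show ?thesis
      using D(2) from_nat_into_surj [OF D(1)] by (intro exI[of _ "from_nat_into D"]) metis
  qed
  then obtain p :: "nat \<Rightarrow> nat \<Rightarrow> 'x" where p: "\<And>n x. \<exists>i. dist x (p n i) < inverse (Suc n)"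
    by metis
  \<comment> \<open>Taking the least admissible index, rather than an arbitrary one, makes the
    choice measurable in \<open>x\<close>.\<close>
  define \<iota> where "\<iota> n x = (LEAST i. dist x (p n i) < inverse (Suc n))" for n x
  have close: "dist x (p n (\<iota> n x)) < inverse (Suc n)" for n x
    unfolding \<iota>_def by (rule LeastI_ex) (rule p)
  have lim: "(\<lambda>n. p n (\<iota> n x)) \<longlonglongrightarrow> x" for x
  proof (rule metric_LIMSEQ_I)
    fix r :: real assume "r > 0"
    then obtain m :: nat where m: "inverse (Suc m) < r"
      using reals_Archimedean by blast
    have "dist (p n (\<iota> n x)) x < r" if "m \<le> n" for n
    proof -
      have "inverse (real (Suc n)) \<le> inverse (Suc m)"
        using that by simp
      then show ?thesis
        using close [of x n] m by (subst dist_commute) linarith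
    qed
    then show "\<exists>no. \<forall>n\<ge>no. dist (p n (\<iota> n x)) x < r"
      by blast
  qed
  have \<iota>_meas: "\<iota> n \<in> measurable M (count_space UNIV)" for n
  proof -
    have [measurable]: "(\<lambda>x. dist x (p n i)) \<in> borel_measurable M" for i
      unfolding measurable_cong_sets [OF sets refl]
      by (intro borel_measurable_continuous_onI continuous_intros)
    show ?thesis
      unfolding \<iota>_def by measurable
  qed
  show ?thesis
  proof (rule borel_measurable_LIMSEQ_real)
    show "(\<lambda>n. f (p n (\<iota> n (fst z))) (snd z)) \<longlonglongrightarrow> (\<lambda>(x, y). f x y) z" for z
    proof -
      have "isCont (\<lambda>x. f x (snd z)) (fst z)"
        using cont continuous_on_eq_continuous_at by blast
      from isCont_tendsto_compose [OF this lim] show ?thesis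
        by (simp add: case_prod_beta)
    qed
    fix n
    have [measurable]: "(\<lambda>z. \<iota> n (fst z)) \<in> measurable (M \<Otimes>\<^sub>M N) (count_space UNIV)"
      by (intro measurable_compose [OF measurable_fst \<iota>_meas])
    have "(\<lambda>z. f (p n i) (snd z)) \<in> borel_measurable (M \<Otimes>\<^sub>M N)" for i
      by (intro measurable_compose [OF measurable_snd meas])
    then show "(\<lambda>z. f (p n (\<iota> n (fst z))) (snd z)) \<in> borel_measurable (M \<Otimes>\<^sub>M N)"
      by (rule measurable_compose_countable) measurable
  qed
qed

lemma Schur_test:
  fixes K :: "'a \<Rightarrow> 'a \<Rightarrow> real" and w h :: "'a \<Rightarrow> real"
  assumes "sigma_finite_measure \<nu>"
    and [measurable]: "(\<lambda>(x, y). K x y) \<in> borel_measurable (\<nu> \<Otimes>\<^sub>M \<nu>)"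
      "w \<in> borel_measurable \<nu>" "h \<in> borel_measurable \<nu>"
    and K: "\<And>x y. 0 \<le> K x y" "\<And>x y. K x y = K y x" and w: "\<And>x. 0 < w x" and h: "\<And>x. 0 \<le> h x"
    and bound: "\<And>x. (\<integral>\<^sup>+y. ennreal (K x y * w y) \<partial>\<nu>) \<le> ennreal (\<Lambda> * w x)" and "0 \<le> \<Lambda>"
  shows "(\<integral>\<^sup>+x. \<integral>\<^sup>+y. ennreal (K x y * h x * h y) \<partial>\<nu> \<partial>\<nu>) \<le> ennreal \<Lambda> * (\<integral>\<^sup>+x. ennreal ((h x)\<^sup>2) \<partial>\<nu>)"
proof -
  interpret sigma_finite_measure \<nu> by fact
  interpret pair_sigma_finite \<nu> \<nu> ..
  define a where "a x y = ennreal (K x y * w y / w x * (h x)\<^sup>2 / 2)" for x y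
  have [measurable]: "(\<lambda>(x, y). a x y) \<in> borel_measurable (\<nu> \<Otimes>\<^sub>M \<nu>)"
    unfolding a_def by measurable
  have *: "ennreal (K x y * h x * h y) \<le> a x y + a y x" for x y
  proof -
    have "0 \<le> (w y * h x - w x * h y)\<^sup>2"
      by simp
    then have "h x * h y \<le> w y / w x * (h x)\<^sup>2 / 2 + w x / w y * (h y)\<^sup>2 / 2"
      using w [of x] w [of y] by (simp add: field_simps power2_eq_square)
    then have "K x y * (h x * h y) \<le> K x y * (w y / w x * (h x)\<^sup>2 / 2 + w x / w y * (h y)\<^sup>2 / 2)"
      by (rule mult_left_mono) (rule K)
    then have "ennreal (K x y * h x * h y) \<le>
        ennreal (K x y * w y / w x * (h x)\<^sup>2 / 2 + K x y * w x / w y * (h y)\<^sup>2 / 2)"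
      by (intro ennreal_leI) (simp add: algebra_simps)
    also have "\<dots> = a x y + a y x"
      unfolding a_def K(2) [of y x] using K(1) [of x y] w [of x] w [of y]
      by (intro ennreal_plus) auto
    finally show ?thesis .
  qed
  have "(\<integral>\<^sup>+x. \<integral>\<^sup>+y. ennreal (K x y * h x * h y) \<partial>\<nu> \<partial>\<nu>) \<le> (\<integral>\<^sup>+x. \<integral>\<^sup>+y. a x y + a y x \<partial>\<nu> \<partial>\<nu>)"
    by (intro nn_integral_mono *)
  also have "\<dots> = (\<integral>\<^sup>+x. \<integral>\<^sup>+y. a x y \<partial>\<nu> \<partial>\<nu>) + (\<integral>\<^sup>+x. \<integral>\<^sup>+y. a y x \<partial>\<nu> \<partial>\<nu>)"
  proof -
    have [measurable]: "(\<lambda>(x, y). a y x) \<in> borel_measurable (\<nu> \<Otimes>\<^sub>M \<nu>)"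
      by measurable
    have "(\<integral>\<^sup>+y. a x y + a y x \<partial>\<nu>) = (\<integral>\<^sup>+y. a x y \<partial>\<nu>) + (\<integral>\<^sup>+y. a y x \<partial>\<nu>)" if "x \<in> space \<nu>" for x
      using that by (intro nn_integral_add) measurable
    then show ?thesis
      by (simp add: nn_integral_add cong: nn_integral_cong)
  qed
  also have "(\<integral>\<^sup>+x. \<integral>\<^sup>+y. a y x \<partial>\<nu> \<partial>\<nu>) = (\<integral>\<^sup>+x. \<integral>\<^sup>+y. a x y \<partial>\<nu> \<partial>\<nu>)"
    by (rule Fubini') simp
  also have "(\<integral>\<^sup>+x. \<integral>\<^sup>+y. a x y \<partial>\<nu> \<partial>\<nu>) \<le> (\<integral>\<^sup>+x. ennreal (\<Lambda> / 2) * ennreal ((h x)\<^sup>2) \<partial>\<nu>)"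
  proof (rule nn_integral_mono)
    fix x assume "x \<in> space \<nu>"
    then have [measurable]: "K x \<in> borel_measurable \<nu>"
      using measurable_Pair2 [OF assms(2)] by simp
    have "(\<integral>\<^sup>+y. a x y \<partial>\<nu>) = (\<integral>\<^sup>+y. ennreal ((h x)\<^sup>2 / (2 * w x)) * ennreal (K x y * w y) \<partial>\<nu>)"
      unfolding a_def using K(1) less_imp_le [OF w]
      by (intro nn_integral_cong) (simp add: ennreal_mult'' [symmetric] mult_ac)
    also have "\<dots> = ennreal ((h x)\<^sup>2 / (2 * w x)) * (\<integral>\<^sup>+y. ennreal (K x y * w y) \<partial>\<nu>)"
      by (rule nn_integral_cmult) measurable
    also have "\<dots> \<le> ennreal ((h x)\<^sup>2 / (2 * w x)) * ennreal (\<Lambda> * w x)"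
      by (intro mult_left_mono bound) simp
    also have "\<dots> = ennreal (\<Lambda> / 2) * ennreal ((h x)\<^sup>2)"
      using w [of x] \<open>0 \<le> \<Lambda>\<close> by (simp add: ennreal_mult'' [symmetric] mult_ac)
    finally show "(\<integral>\<^sup>+y. a x y \<partial>\<nu>) \<le> ennreal (\<Lambda> / 2) * ennreal ((h x)\<^sup>2)" .
  qed
  also have "\<dots> = ennreal (\<Lambda> / 2) * (\<integral>\<^sup>+x. ennreal ((h x)\<^sup>2) \<partial>\<nu>)"
    by (rule nn_integral_cmult) measurable
  finally have "(\<integral>\<^sup>+x. \<integral>\<^sup>+y. ennreal (K x y * h x * h y) \<partial>\<nu> \<partial>\<nu>)
    \<le> ennreal (\<Lambda> / 2) * (\<integral>\<^sup>+x. ennreal ((h x)\<^sup>2) \<partial>\<nu>) + ennreal (\<Lambda> / 2) * (\<integral>\<^sup>+x. ennreal ((h x)\<^sup>2) \<partial>\<nu>)"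
    by (meson add_mono order_trans)
  also have "\<dots> = ennreal \<Lambda> * (\<integral>\<^sup>+x. ennreal ((h x)\<^sup>2) \<partial>\<nu>)"
    using \<open>0 \<le> \<Lambda>\<close> by (simp add: distrib_right [symmetric] ennreal_plus [symmetric] del: ennreal_plus)
  finally show ?thesis .
qed

section \<open>Toeplitz operators of a Parseval frame\<close>

lemma mult_le_half_sum_squares: "a * b \<le> (a\<^sup>2 + (b::real)\<^sup>2) / 2"
  using sum_squares_bound [of a b] by simp

lemma norm_integral_le:
  fixes f :: "'a \<Rightarrow> 'b::{banach, second_countable_topology}"
  assumes "integrable M f" "integrable M g" "\<And>x. norm (f x) \<le> g x"
  shows "norm (integral\<^sup>L M f) \<le> integral\<^sup>L M g"
  by (rule order_trans [OF integral_norm_bound integral_mono]) (use assms in auto)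

lemma has_weak_integral_unique:
  assumes "has_weak_integral M F u" "has_weak_integral M F v"
  shows "u = v"
  by (rule cinner_eqI) (metis assms has_weak_integral_def)

text \<open>Isolates the analysis of the frame from the geometry of the group action.\<close>

locale parseval_frame =
  fixes \<mu> :: "'x::metric_space measure" and k :: "'x \<Rightarrow> 'h::chilbert_space"
  assumes sets_eq: "sets \<mu> = sets borel" and frame: "continuous_parseval_frame \<mu> k"
begin

lemma continuous_frame: "continuous_on UNIV k"
  using frame by (simp add: continuous_parseval_frame_def)

lemma borel_measurable_if_continuous:
  fixes f :: "'x \<Rightarrow> 'b::topological_space"
  assumes "continuous_on UNIV f"
  shows "f \<in> borel_measurable \<mu>"
  unfolding measurable_cong_sets [OF sets_eq refl]
  using assms by (rule borel_measurable_continuous_onI)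

lemma measurable_coefficient [measurable]:
  "(\<lambda>x. cinner f (k x)) \<in> borel_measurable \<mu>" "(\<lambda>x. cinner (k x) f) \<in> borel_measurable \<mu>"
  by (intro borel_measurable_if_continuous cinner.continuous_on continuous_on_const
      continuous_frame)+

lemma coefficient_square:
  "cinner f x * cinner x f = complex_of_real ((cmod (cinner f x))\<^sup>2)"
  unfolding complex_norm_square by (subst cinner_commute [of x f]) simp

lemma parseval:
  "integrable \<mu> (\<lambda>x. cinner f (k x) * cinner (k x) g)"
  "(\<integral>x. cinner f (k x) * cinner (k x) g \<partial>\<mu>) = cinner f g"
  using frame by (auto simp: continuous_parseval_frame_def has_weak_integral_def cinner_scaleC_left)

lemma integrable_coefficient_square: "integrable \<mu> (\<lambda>x. (cmod (cinner f (k x)))\<^sup>2)"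
  using integrable_Re [OF parseval(1) [of f f]] by (simp add: coefficient_square)

lemma integral_coefficient_square: "(\<integral>x. (cmod (cinner f (k x)))\<^sup>2 \<partial>\<mu>) = (norm f)\<^sup>2"
proof -
  have "complex_of_real (\<integral>x. (cmod (cinner f (k x)))\<^sup>2 \<partial>\<mu>) = complex_of_real ((norm f)\<^sup>2)"
    using parseval(2) [of f f] unfolding coefficient_square cinner_self by (simp only: integral_complex_of_real)
  then show ?thesis
    using of_real_eq_iff by blast
qed

lemma nn_integral_coefficient_square:
  "(\<integral>\<^sup>+x. ennreal ((cmod (cinner f (k x)))\<^sup>2) \<partial>\<mu>) = ennreal ((norm f)\<^sup>2)"
  by (subst nn_integral_eq_integral) (auto simp: integrable_coefficient_square integral_coefficient_square)

lemma eq_zero_if_orthogonal_frame: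
  assumes "\<And>x. cinner f (k x) = 0"
  shows "f = 0"
  using integral_coefficient_square [of f] assms by simp

section \<open>Toeplitz operators with bounded symbols, defined weakly\<close>

text \<open>The bounds hold everywhere, so that no null sets have to be carried along; an
  essentially bounded symbol is replaced by such a representative in the final theorem.\<close>

definition bounded_symbol :: "real \<Rightarrow> ('x \<Rightarrow> real) \<Rightarrow> bool"
  where "bounded_symbol C s \<longleftrightarrow> s \<in> borel_measurable \<mu> \<and> (\<forall>x. 0 \<le> s x \<and> s x \<le> C)"

lemma bounded_symbol_measurable [measurable_dest]: "bounded_symbol C s \<Longrightarrow> s \<in> borel_measurable \<mu>"
  by (simp add: bounded_symbol_def)

lemma bounded_symbol_times_indicator:
  "bounded_symbol C s \<Longrightarrow> A \<in> sets \<mu> \<Longrightarrow> bounded_symbol C (\<lambda>x. indicator A x * s x)"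
  by (auto simp: bounded_symbol_def indicator_def intro: order_trans)

text \<open>Pointwise majorant of the form, integrable because both squares are, by the Parseval
  identity.\<close>

lemma norm_form_le:
  assumes "bounded_symbol C s"
  shows "norm (s x *\<^sub>R (cinner f (k x) * cinner (k x) g)) \<le>
    C / 2 * ((cmod (cinner f (k x)))\<^sup>2 + (cmod (cinner g (k x)))\<^sup>2)"
proof -
  have "s x * (cmod (cinner f (k x)) * cmod (cinner g (k x))) \<le>
      C * (((cmod (cinner f (k x)))\<^sup>2 + (cmod (cinner g (k x)))\<^sup>2) / 2)"
    using assms by (intro mult_mono mult_le_half_sum_squares) (auto simp: bounded_symbol_def intro: order_trans)
  then show ?thesis
    using assms by (simp add: norm_mult cmod_cinner_commute [of "k x" g] bounded_symbol_def)
qed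

lemma integrable_form:
  assumes "bounded_symbol C s"
  shows "integrable \<mu> (\<lambda>x. s x *\<^sub>R (cinner f (k x) * cinner (k x) g))"
proof (rule Bochner_Integration.integrable_bound)
  show "integrable \<mu> (\<lambda>x. C / 2 * ((cmod (cinner f (k x)))\<^sup>2 + (cmod (cinner g (k x)))\<^sup>2))"
    by (intro integrable_mult_right Bochner_Integration.integrable_add integrable_coefficient_square)
  note [measurable] = bounded_symbol_measurable [OF assms]
  show "(\<lambda>x. s x *\<^sub>R (cinner f (k x) * cinner (k x) g)) \<in> borel_measurable \<mu>"
    by measurable
  show "AE x in \<mu>. norm (s x *\<^sub>R (cinner f (k x) * cinner (k x) g)) \<le>
    norm (C / 2 * ((cmod (cinner f (k x)))\<^sup>2 + (cmod (cinner g (k x)))\<^sup>2))"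
    by (intro AE_I2) (metis norm_form_le [OF assms] abs_ge_self order_trans real_norm_def)
qed

text \<open>Justifies the definite description in \<open>toeplitz\<close>: existence comes from the
  Riesz representation, uniqueness from \<open>has_weak_integral_unique\<close>.\<close>

lemma has_weak_integral_toeplitz:
  assumes s: "bounded_symbol C s"
  shows "has_weak_integral \<mu> (\<lambda>x. s x *\<^sub>R cinner f (k x) *\<^sub>C k x) (toeplitz \<mu> k s f)"
proof -
  \<comment> \<open>The form is conjugate-linear in its second argument, whereas the Riesz lemma
    represents linear functionals; hence \<open>f\<close> and \<open>g\<close> are exchanged here
    and a conjugate undoes this below.\<close>
  define F where "F g = (\<integral>x. s x *\<^sub>R (cinner g (k x) * cinner (k x) f) \<partial>\<mu>)" for g
  have scale: "F (c *\<^sub>C g) = c * F g" for c g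
    unfolding F_def by (simp add: cinner_scaleC_left mult.assoc flip: integral_mult_right_zero)
  have small: "cmod (F g) \<le> C / 2 * ((norm f)\<^sup>2 + (norm g)\<^sup>2)" for g
  proof -
    have "cmod (F g) \<le> (\<integral>x. C / 2 * ((cmod (cinner g (k x)))\<^sup>2 + (cmod (cinner f (k x)))\<^sup>2) \<partial>\<mu>)"
      unfolding F_def
      by (intro norm_integral_le integrable_form [OF s] norm_form_le [OF s]
          integrable_mult_right Bochner_Integration.integrable_add integrable_coefficient_square)
    then show ?thesis
      by (simp add: integrable_coefficient_square integral_coefficient_square algebra_simps)
  qed
  \<comment> \<open>The bound \<open>small\<close> is not homogeneous in \<open>g\<close>. Applying
    it to the unit vector in direction \<open>g\<close> and scaling back gives a bound linear in
    \<open>norm g\<close>.\<close>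
  have "cmod (F g) \<le> C / 2 * ((norm f)\<^sup>2 + 1) * norm g" for g
  proof (cases "g = 0")
    case True
    then show ?thesis
      by (simp add: F_def cinner.zero_left)
  next
    case False
    have "g = complex_of_real (norm g) *\<^sub>C inverse (norm g) *\<^sub>R g"
      using False by (simp flip: scaleR_scaleC)
    then have "cmod (F g) = norm g * cmod (F (inverse (norm g) *\<^sub>R g))"
      by (metis scale norm_mult norm_of_real abs_norm_cancel)
    also have "\<dots> \<le> norm g * (C / 2 * ((norm f)\<^sup>2 + 1))"
      using small [of "inverse (norm g) *\<^sub>R g"] False by (intro mult_left_mono) auto
    finally show ?thesis
      by (simp add: mult_ac)
  qed
  moreover have "F (g + h) = F g + F h" for g h
    unfolding F_def
    by (subst Bochner_Integration.integral_add [symmetric])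
      (auto intro: integrable_form [OF s] simp: cinner_add_left algebra_simps)
  ultimately obtain v where v: "\<And>g. F g = cinner g v"
    using Riesz_representation [of F] scale by metis
  have v_integral: "has_weak_integral \<mu> (\<lambda>x. s x *\<^sub>R cinner f (k x) *\<^sub>C k x) v"
    unfolding has_weak_integral_def
  proof (intro allI conjI)
    fix g
    show "integrable \<mu> (\<lambda>x. cinner (s x *\<^sub>R cinner f (k x) *\<^sub>C k x) g)"
      using integrable_form [OF s] by (simp add: cinner_scaleR_left cinner_scaleC_left)
    have "(\<integral>x. cinner (s x *\<^sub>R cinner f (k x) *\<^sub>C k x) g \<partial>\<mu>) = cnj (F g)"
      unfolding F_def Bochner_Integration.integral_cnj [symmetric]
      by (simp add: cinner_scaleR_left cinner_scaleC_left cinner_commute [of g]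
          cinner_commute [of "k _" f] scaleR_conv_of_real mult_ac del: Bochner_Integration.integral_cnj)
    then show "(\<integral>x. cinner (s x *\<^sub>R cinner f (k x) *\<^sub>C k x) g \<partial>\<mu>) = cinner v g"
      unfolding v by (simp add: cinner_commute [of v])
  qed
  then show ?thesis
    unfolding toeplitz_def
    by (rule theI) (rule has_weak_integral_unique [OF _ v_integral])
qed

lemma cinner_toeplitz:
  assumes "bounded_symbol C s"
  shows "cinner (toeplitz \<mu> k s f) g = (\<integral>x. s x *\<^sub>R (cinner f (k x) * cinner (k x) g) \<partial>\<mu>)"
  using has_weak_integral_toeplitz [OF assms]
  by (simp add: has_weak_integral_def cinner_scaleR_left cinner_scaleC_left)

text \<open>Allows a change of representative. The two definite descriptions have equivalent
  predicates, so neither existence nor boundedness enters.\<close>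

lemma toeplitz_cong_AE:
  assumes [measurable]: "s \<in> borel_measurable \<mu>" "t \<in> borel_measurable \<mu>" and AE: "AE x in \<mu>. s x = t x"
  shows "toeplitz \<mu> k s = toeplitz \<mu> k t"
proof
  fix f
  have *: "cinner (r *\<^sub>R cinner f (k x) *\<^sub>C k x) g = r *\<^sub>R (cinner f (k x) * cinner (k x) g)" for r x g
    by (simp add: cinner_scaleR_left cinner_scaleC_left)
  have "integrable \<mu> (\<lambda>x. s x *\<^sub>R (cinner f (k x) * cinner (k x) g)) \<longleftrightarrow>
      integrable \<mu> (\<lambda>x. t x *\<^sub>R (cinner f (k x) * cinner (k x) g))" for g
    by (rule integrable_cong_AE) (use AE in auto)
  moreover have "(\<integral>x. s x *\<^sub>R (cinner f (k x) * cinner (k x) g) \<partial>\<mu>) =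
      (\<integral>x. t x *\<^sub>R (cinner f (k x) * cinner (k x) g) \<partial>\<mu>)" for g
    by (rule integral_cong_AE) (use AE in auto)
  ultimately show "toeplitz \<mu> k s f = toeplitz \<mu> k t f"
    unfolding toeplitz_def has_weak_integral_def * by simp
qed

lemma linear_toeplitz:
  assumes s: "bounded_symbol C s"
  shows "Vector_Spaces.linear scaleC scaleC (toeplitz \<mu> k s)"
  unfolding linear_scaleC_iff
proof (intro conjI allI)
  note integrable = integrable_form [OF s]
  show "toeplitz \<mu> k s (f + g) = toeplitz \<mu> k s f + toeplitz \<mu> k s g" for f g
    by (rule cinner_eqI)
      (simp add: cinner_add_left cinner_toeplitz [OF s] integrable distrib_right scaleR_right_distrib)
  show "toeplitz \<mu> k s (c *\<^sub>C f) = c *\<^sub>C toeplitz \<mu> k s f" for c f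
    by (rule cinner_eqI) (simp add: cinner_scaleC_left cinner_toeplitz [OF s] mult.assoc
        flip: integral_mult_right_zero)
qed

lemma toeplitz_self_adjoint:
  assumes s: "bounded_symbol C s"
  shows "cinner (toeplitz \<mu> k s f) g = cinner f (toeplitz \<mu> k s g)"
proof -
  have "cinner f (toeplitz \<mu> k s g) = cnj (cinner (toeplitz \<mu> k s g) f)"
    by (rule cinner_commute)
  also have "\<dots> = (\<integral>x. cnj (s x *\<^sub>R (cinner g (k x) * cinner (k x) f)) \<partial>\<mu>)"
    unfolding cinner_toeplitz [OF s] by (rule Bochner_Integration.integral_cnj [symmetric])
  also have "\<dots> = cinner (toeplitz \<mu> k s f) g"
    unfolding cinner_toeplitz [OF s]
    by (intro Bochner_Integration.integral_cong refl)
      (simp add: cinner_commute [of g] cinner_commute [of "k _" f] mult_ac)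
  finally show ?thesis ..
qed

text \<open>Splitting \<open>|f|K\<close> into \<open>tK\<^sup>2/2\<close> and an excess bounded by the integrable \<open>|f|\<^sup>2/(2t)\<close> makes
  dominated convergence applicable.\<close>

lemma tendsto_coefficient_zero:
  assumes lim: "\<And>x. (\<lambda>n. cmod (cinner (k x) (k (y n)))) \<longlonglongrightarrow> 0" and bound: "\<And>x. norm (k x) \<le> c"
  shows "(\<lambda>n. cinner f (k (y n))) \<longlonglongrightarrow> 0"
proof (rule LIMSEQ_I)
  fix e :: real assume "e > 0"
  \<comment> \<open>In the final estimate the \<open>K\<^sup>2\<close> part contributes at most
    \<open>t * c\<^sup>2 / 2\<close>, by Parseval for \<open>k (y n)\<close>; this choice puts it
    below \<open>e / 2\<close>.\<close>
  define t where "t = e / (c\<^sup>2 + 1)"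
  have "c\<^sup>2 + 1 > 0"
    by (simp add: add_nonneg_pos)
  then have "t > 0" "t * c\<^sup>2 < e"
    using \<open>e > 0\<close> by (auto simp: t_def field_simps)
  define F where "F x = cmod (cinner f (k x))" for x
  define K where "K n x = cmod (cinner (k (y n)) (k x))" for n x
  define b where "b n x = max 0 (F x * K n x - t / 2 * (K n x)\<^sup>2)" for n x
  have [measurable]: "F \<in> borel_measurable \<mu>" "K n \<in> borel_measurable \<mu>" for n
    unfolding F_def K_def by measurable
  have b_le: "b n x \<le> 1 / (2 * t) * (F x)\<^sup>2" for n x
  proof -
    have "0 \<le> (F x - t * K n x)\<^sup>2"
      by simp
    then have "F x * K n x - t / 2 * (K n x)\<^sup>2 \<le> 1 / (2 * t) * (F x)\<^sup>2"
      using \<open>t > 0\<close> by (simp add: field_simps power2_eq_square)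
    then show ?thesis
      using \<open>t > 0\<close> by (simp add: b_def)
  qed
  have F2: "integrable \<mu> (\<lambda>x. 1 / (2 * t) * (F x)\<^sup>2)"
    unfolding F_def by (intro integrable_mult_right integrable_coefficient_square)
  have b_int: "integrable \<mu> (b n)" for n
  proof (rule Bochner_Integration.integrable_bound [OF F2])
    show "AE x in \<mu>. norm (b n x) \<le> norm (1 / (2 * t) * (F x)\<^sup>2)"
    proof (rule AE_I2)
      show "norm (b n x) \<le> norm (1 / (2 * t) * (F x)\<^sup>2)" for x
        using b_le [of n x] \<open>t > 0\<close> by (simp add: b_def)
    qed
  qed (simp add: b_def [abs_def])
  have "(\<lambda>n. integral\<^sup>L \<mu> (b n)) \<longlonglongrightarrow> (\<integral>x. 0 \<partial>\<mu>)"
  proof (rule integral_dominated_convergence [OF _ _ F2])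
    show "AE x in \<mu>. (\<lambda>n. b n x) \<longlonglongrightarrow> 0"
    proof (rule AE_I2)
      fix x
      have "(\<lambda>n. K n x) \<longlonglongrightarrow> 0"
        using lim [of x] by (simp add: K_def cmod_cinner_commute)
      then have "(\<lambda>n. b n x) \<longlonglongrightarrow> max 0 (F x * 0 - t / 2 * 0\<^sup>2)"
        unfolding b_def by (intro tendsto_intros)
      then show "(\<lambda>n. b n x) \<longlonglongrightarrow> 0"
        by simp
    qed
    show "AE x in \<mu>. norm (b n x) \<le> 1 / (2 * t) * (F x)\<^sup>2" for n
      using b_le by (auto simp: b_def)
  qed (auto simp: b_def [abs_def])
  then obtain N where N: "\<And>n. n \<ge> N \<Longrightarrow> integral\<^sup>L \<mu> (b n) < e / 2"
    using LIMSEQ_D [of _ _ "e / 2"] \<open>e > 0\<close> by (fastforce simp: abs_less_iff)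
  have "norm (cinner f (k (y n))) < e" if "n \<ge> N" for n
  proof -
    have K2: "integrable \<mu> (\<lambda>x. t / 2 * (K n x)\<^sup>2)"
      unfolding K_def by (intro integrable_mult_right integrable_coefficient_square)
    have "norm (cinner f (k (y n))) \<le> (\<integral>x. b n x + t / 2 * (K n x)\<^sup>2 \<partial>\<mu>)"
      by (subst parseval(2) [symmetric], rule norm_integral_le [OF parseval(1) Bochner_Integration.integrable_add [OF b_int K2]])
        (simp add: b_def F_def K_def norm_mult cmod_cinner_commute)
    also have "\<dots> = integral\<^sup>L \<mu> (b n) + t / 2 * (norm (k (y n)))\<^sup>2"
      using b_int K2 by (simp add: K_def integral_coefficient_square integrable_coefficient_square)
    also have "\<dots> < e / 2 + t / 2 * c\<^sup>2"
      using N [OF that] bound \<open>t > 0\<close>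
      by (intro add_less_le_mono mult_left_mono power_mono) auto
    also have "\<dots> < e"
      using \<open>t * c\<^sup>2 < e\<close> by simp
    finally show ?thesis .
  qed
  then show "\<exists>no. \<forall>n\<ge>no. norm (cinner f (k (y n)) - 0) < e"
    by auto
qed

end

section \<open>Compact operators\<close>

lemma compact_closure_if_subset:
  fixes K :: "'a::t2_space set"
  assumes "compact K" "S \<subseteq> K"
  shows "compact (closure S)"
  using compact_Int_closed [OF assms(1) closed_closure [of S]]
    closure_minimal [OF assms(2) compact_imp_closed [OF assms(1)]] by (simp add: inf.absorb2)

text \<open>In a complete space only total boundedness is at stake. The three thirds of
  \<open>e\<close> pay for the steps from \<open>closure S\<close> to \<open>S\<close>, from
  \<open>S\<close> to \<open>K\<close>, and from \<open>K\<close> to its finite net.\<close>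

lemma compact_closure_if_near_compact:
  fixes S :: "'a::{metric_space, complete_space} set"
  assumes near: "\<And>e. e > 0 \<Longrightarrow> \<exists>K. compact K \<and> (\<forall>x\<in>S. \<exists>y\<in>K. dist x y < e)"
  shows "compact (closure S)"
  unfolding compact_eq_totally_bounded
proof (intro conjI allI impI)
  show "complete (closure S)"
    by (simp add: complete_eq_closed)
  fix e :: real assume "e > 0"
  then obtain K where K: "compact K" "\<And>x. x \<in> S \<Longrightarrow> \<exists>y\<in>K. dist x y < e / 3"
    using near [of "e / 3"] by auto
  moreover obtain N where N: "finite N" "K \<subseteq> (\<Union>p\<in>N. ball p (e / 3))"
    using \<open>e > 0\<close> K(1) unfolding compact_eq_totally_bounded by (metis divide_pos_pos zero_less_numeral)
  have "closure S \<subseteq> (\<Union>p\<in>N. ball p e)"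
  proof
    fix x assume "x \<in> closure S"
    then obtain s where s: "s \<in> S" "dist s x < e / 3"
      using \<open>e > 0\<close> closure_approachable [of x S] by (metis divide_pos_pos zero_less_numeral)
    then obtain y where y: "y \<in> K" "dist s y < e / 3"
      using K by blast
    then obtain p where p: "p \<in> N" "dist p y < e / 3"
      using N(2) by auto
    have "dist p x < e"
      using dist_triangle [of p x y] dist_triangle [of y x s] s(2) y(2) p(2)
      by (simp add: dist_commute)
    then show "x \<in> (\<Union>p\<in>N. ball p e)"
      using p(1) by auto
  qed
  then show "\<exists>N. finite N \<and> closure S \<subseteq> (\<Union>p\<in>N. ball p e)"
    using N(1) by blast
qed

text \<open>Limits in operator norm of compact operators are compact, since on a bounded set the
  values of \<open>T\<close> are uniformly close to a relatively compact set.\<close>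

lemma compact_operator_limit:
  fixes T :: "'h::chilbert_space \<Rightarrow> 'h"
  assumes "Vector_Spaces.linear scaleC scaleC T"
    and approx: "\<And>e. e > 0 \<Longrightarrow> \<exists>S. compact_operator S \<and> (\<forall>f. norm (T f - S f) \<le> e * norm f)"
  shows "compact_operator T"
  unfolding compact_operator_def
proof (intro conjI allI impI assms)
  fix B :: "'h set" assume "bounded B"
  then obtain b where b: "b > 0" "\<And>f. f \<in> B \<Longrightarrow> norm f \<le> b"
    by (auto simp: bounded_pos)
  show "compact (closure (T ` B))"
  proof (rule compact_closure_if_near_compact)
    fix e :: real assume "e > 0"
    then obtain S where S: "compact_operator S" "\<And>f. norm (T f - S f) \<le> e / (2 * b) * norm f"
      using approx [of "e / (2 * b)"] b(1) by auto
    have "dist (T f) (S f) < e" if "f \<in> B" for f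
    proof -
      have "norm (T f - S f) \<le> e / (2 * b) * b"
        using \<open>e > 0\<close> b(1) by (intro order_trans [OF S(2)] mult_left_mono b(2) that) auto
      then show ?thesis
        using \<open>e > 0\<close> b(1) by (simp add: dist_norm)
    qed
    moreover have "compact (closure (S ` B))"
      using S(1) \<open>bounded B\<close> by (simp add: compact_operator_def)
    moreover have "S f \<in> closure (S ` B)" if "f \<in> B" for f
      using that closure_subset [of "S ` B"] by auto
    ultimately show "\<exists>K. compact K \<and> (\<forall>x\<in>T ` B. \<exists>y\<in>K. dist x y < e)"
      by (intro exI[of _ "closure (S ` B)"] conjI) auto
  qed
qed

lemma compact_operator_add:
  assumes S: "compact_operator S" and T: "compact_operator T"
  shows "compact_operator (\<lambda>f. S f + T f)"
  unfolding compact_operator_def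
proof (intro conjI allI impI)
  show "Vector_Spaces.linear (*\<^sub>C) (*\<^sub>C) (\<lambda>f. S f + T f)"
    using S T by (simp add: compact_operator_def linear_scaleC_iff scaleC_add_right)
  fix B :: "'a set" assume "bounded B"
  let ?K = "{x + y | x y. x \<in> closure (S ` B) \<and> y \<in> closure (T ` B)}"
  have "compact ?K"
    using S T \<open>bounded B\<close> by (intro compact_sums) (auto simp: compact_operator_def)
  moreover have "(\<lambda>f. S f + T f) ` B \<subseteq> ?K"
    using closure_subset [of "S ` B"] closure_subset [of "T ` B"] by blast
  ultimately show "compact (closure ((\<lambda>f. S f + T f) ` B))"
    by (rule compact_closure_if_subset)
qed

lemma compact_operator_zero: "compact_operator (\<lambda>f. 0)"
proof -
  have "c *\<^sub>C 0 = (0::'a)" for c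
    using scaleC_add_right [of c 0 0] by simp
  moreover have "compact (closure ((\<lambda>f::'a. 0::'a) ` B))" for B
    by (rule compact_closure_if_subset [of "{0}"]) auto
  ultimately show ?thesis
    by (simp add: compact_operator_def linear_scaleC_iff)
qed

text \<open>By Cauchy-Schwarz the coefficients of a bounded set fill at most a compact disc of
  scalars, and the image of this disc under \<open>z \<mapsto> z v\<close> is compact.\<close>

lemma compact_operator_rank_one: "compact_operator (\<lambda>f. cinner f u *\<^sub>C v)"
  unfolding compact_operator_def
proof (intro conjI allI impI)
  show "Vector_Spaces.linear (*\<^sub>C) (*\<^sub>C) (\<lambda>f. cinner f u *\<^sub>C v)"
    by (simp add: linear_scaleC_iff cinner_add_left scaleC_add_left cinner_scaleC_left scaleC_scaleC)
  fix B :: "'a set" assume "bounded B"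
  then obtain b where b: "\<And>f. f \<in> B \<Longrightarrow> norm f \<le> b"
    by (auto simp: bounded_iff)
  have "bounded_linear (\<lambda>z. z *\<^sub>C v)"
  proof (rule bounded_linear_intro [where K = "norm v"])
    show "(r *\<^sub>R z) *\<^sub>C v = r *\<^sub>R (z *\<^sub>C v)" for r z
      by (simp add: scaleR_scaleC [of r "z *\<^sub>C v"] scaleC_scaleC scaleR_conv_of_real)
  qed (auto simp: scaleC_add_left)
  then have "compact ((\<lambda>z. z *\<^sub>C v) ` cball 0 (b * norm u))"
    by (intro compact_continuous_image linear_continuous_on compact_cball)
  moreover have "(\<lambda>f. cinner f u *\<^sub>C v) ` B \<subseteq> (\<lambda>z. z *\<^sub>C v) ` cball 0 (b * norm u)"
  proof -
    have "cmod (cinner f u) \<le> b * norm u" if "f \<in> B" for f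
      using cinner_Cauchy_Schwarz [of f u] mult_right_mono [OF b [OF that], of "norm u"] by simp
    then show ?thesis
      by auto
  qed
  ultimately show "compact (closure ((\<lambda>f. cinner f u *\<^sub>C v) ` B))"
    by (rule compact_closure_if_subset)
qed

text \<open>Weakly defined vectors are known only through their pairings; testing the vector against
  itself turns a bound on pairings into a norm bound.\<close>

lemma norm_le_if_cinner_le:
  fixes d :: "'a::complex_inner"
  assumes "cmod (cinner d d) \<le> B * norm d" and "0 \<le> B"
  shows "norm d \<le> B"
proof (cases "d = 0")
  case False
  then show ?thesis
    using assms(1) by (simp add: cinner_self norm_power power2_eq_square norm_mult)
qed (use assms in simp)

section \<open>Symbols on relatively compact sets: approximation by finite-rank operators\<close>

context parseval_frame
begin

lemma toeplitz_add:
  assumes "bounded_symbol C s" "bounded_symbol C t" "bounded_symbol C (\<lambda>x. s x + t x)"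
  shows "toeplitz \<mu> k (\<lambda>x. s x + t x) f = toeplitz \<mu> k s f + toeplitz \<mu> k t f"
  by (rule cinner_eqI) (simp add: cinner_add_left cinner_toeplitz [OF assms(1)]
      cinner_toeplitz [OF assms(2)] cinner_toeplitz [OF assms(3)]
      integrable_form [OF assms(1)] integrable_form [OF assms(2)] scaleR_left_distrib)

lemma toeplitz_split:
  assumes s: "bounded_symbol C s" and [measurable]: "A \<in> sets \<mu>" "B \<in> sets \<mu>"
  shows "toeplitz \<mu> k (\<lambda>x. indicator A x * s x) f =
    toeplitz \<mu> k (\<lambda>x. indicator (A \<inter> B) x * s x) f + toeplitz \<mu> k (\<lambda>x. indicator (A - B) x * s x) f"
proof -
  have *: "(\<lambda>x. indicator A x * s x) = (\<lambda>x. indicator (A \<inter> B) x * s x + indicator (A - B) x * s x)"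
    by (auto simp: indicator_def)
  show ?thesis
    \<comment> \<open>The premise of \<open>toeplitz_add\<close> on the sum is folded back to a
      single indicator, so the bound stays \<open>C\<close> and does not become
      \<open>2 * C\<close>.\<close>
    unfolding * by (rule toeplitz_add [of C]; (subst * [symmetric])?)
      (intro bounded_symbol_times_indicator s; measurable)+
qed

text \<open>On a set where \<open>k\<close> is within \<open>e\<close> of the single vector
  \<open>k p\<close>, replacing \<open>k x\<close> by \<open>k p\<close> in both slots of the form
  leaves a rank-one operator. Each of the two replacements costs
  \<open>C * c * e * measure \<mu> A\<close>, whence the factor 2.\<close>

lemma toeplitz_indicator_rank_one_approx:
  assumes s: "bounded_symbol C s" and [measurable]: "A \<in> sets \<mu>" and fin: "emeasure \<mu> A < \<infinity>"
    and c: "\<And>x. norm (k x) \<le> c" and e: "\<And>x. x \<in> A \<Longrightarrow> norm (k x - k p) \<le> e" and "0 \<le> e"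
  defines "a \<equiv> (\<integral>x. indicator A x * s x \<partial>\<mu>)"
  shows "norm (toeplitz \<mu> k (\<lambda>x. indicator A x * s x) f - cinner f (k p) *\<^sub>C a *\<^sub>R k p)
    \<le> 2 * C * c * e * measure \<mu> A * norm f"
proof (rule norm_le_if_cinner_le)
  note s' = bounded_symbol_times_indicator [OF s \<open>A \<in> sets \<mu>\<close>]
  note [measurable] = bounded_symbol_measurable [OF s]
  have "0 \<le> c"
    using c [of p] norm_ge_zero order_trans by blast
  have "0 \<le> C"
    using s by (auto simp: bounded_symbol_def intro: order_trans)
  then show "0 \<le> 2 * C * c * e * measure \<mu> A * norm f"
    using \<open>0 \<le> c\<close> \<open>0 \<le> e\<close> by simp
  define d where "d = toeplitz \<mu> k (\<lambda>x. indicator A x * s x) f - cinner f (k p) *\<^sub>C a *\<^sub>R k p"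
  have ind: "integrable \<mu> (\<lambda>x. indicator A x :: real)"
    using fin by (simp add: integrable_indicator_iff)
  have "integrable \<mu> (\<lambda>x. indicator A x * s x)"
  proof (rule Bochner_Integration.integrable_bound)
    show "integrable \<mu> (\<lambda>x. C * indicator A x)"
      by (intro integrable_mult_right ind)
    show "AE x in \<mu>. norm (indicator A x * s x) \<le> norm (C * indicator A x)"
      using s by (auto simp: bounded_symbol_def indicator_def intro!: AE_I2 intro: order_trans)
  qed measurable
  then have int: "integrable \<mu> (\<lambda>x. (indicator A x * s x) *\<^sub>R (cinner f (k p) * cinner (k p) d))"
    and "(\<integral>x. (indicator A x * s x) *\<^sub>R (cinner f (k p) * cinner (k p) d) \<partial>\<mu>) =
      cinner (cinner f (k p) *\<^sub>C a *\<^sub>R k p) d"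
    by (auto simp: a_def cinner_scaleC_left cinner_scaleR_left)
  then have "cinner d d = (\<integral>x. (indicator A x * s x) *\<^sub>R (cinner f (k x) * cinner (k x) d)
      - (indicator A x * s x) *\<^sub>R (cinner f (k p) * cinner (k p) d) \<partial>\<mu>)"
    by (subst (1) d_def)
      (simp add: cinner.diff_left cinner_toeplitz [OF s'] integrable_form [OF s'])
  also have "cmod \<dots> \<le> (\<integral>x. 2 * C * c * e * norm f * norm d * indicator A x \<partial>\<mu>)"
  proof (rule norm_integral_le)
    fix x
    show "norm ((indicator A x * s x) *\<^sub>R (cinner f (k x) * cinner (k x) d)
      - (indicator A x * s x) *\<^sub>R (cinner f (k p) * cinner (k p) d))
      \<le> 2 * C * c * e * norm f * norm d * indicator A x"
    proof (cases "x \<in> A")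
      case True
      have prod: "cmod (cinner f u * cinner v d) \<le> norm f * norm u * (norm v * norm d)" for u v
        unfolding norm_mult by (intro mult_mono cinner_Cauchy_Schwarz) auto
      have "norm f * norm (k x - k p) * (norm (k x) * norm d) \<le> norm f * e * (c * norm d)"
        by (intro mult_mono mult_nonneg_nonneg order_refl e True c \<open>0 \<le> e\<close> \<open>0 \<le> c\<close>) auto
      moreover have "norm f * norm (k p) * (norm (k x - k p) * norm d) \<le> norm f * c * (e * norm d)"
        by (intro mult_mono mult_nonneg_nonneg order_refl e True c \<open>0 \<le> e\<close> \<open>0 \<le> c\<close>) auto
      \<comment> \<open>Telescoping: one slot is changed at a time.\<close>
      moreover have "cinner f (k x) * cinner (k x) d - cinner f (k p) * cinner (k p) d =
          cinner f (k x - k p) * cinner (k x) d + cinner f (k p) * cinner (k x - k p) d"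
        by (simp add: cinner.diff_left cinner.diff_right algebra_simps)
      ultimately have "cmod (cinner f (k x) * cinner (k x) d - cinner f (k p) * cinner (k p) d)
          \<le> norm f * e * (c * norm d) + norm f * c * (e * norm d)"
        by (simp only:) (intro norm_triangle_mono order_trans [OF prod]; assumption)
      also have "\<dots> = 2 * c * e * norm f * norm d"
        by simp
      finally have "cmod (cinner f (k x) * cinner (k x) d - cinner f (k p) * cinner (k p) d)
          \<le> 2 * c * e * norm f * norm d" .
      moreover have "0 \<le> s x" "s x \<le> C"
        using s by (auto simp: bounded_symbol_def)
      ultimately have "s x * cmod (cinner f (k x) * cinner (k x) d - cinner f (k p) * cinner (k p) d)
          \<le> C * (2 * c * e * norm f * norm d)"
        using \<open>0 \<le> C\<close> by (intro mult_mono) auto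
      then show ?thesis
        using True \<open>0 \<le> s x\<close> by (simp add: mult_ac flip: scaleR_right_diff_distrib)
    qed simp
  qed (intro Bochner_Integration.integrable_diff integrable_form [OF s'] int integrable_mult_right ind)+
  also have "\<dots> = 2 * C * c * e * measure \<mu> A * norm f * norm d"
    by simp
  finally show "cmod (cinner (toeplitz \<mu> k (\<lambda>x. indicator A x * s x) f - cinner f (k p) *\<^sub>C a *\<^sub>R k p)
      (toeplitz \<mu> k (\<lambda>x. indicator A x * s x) f - cinner f (k p) *\<^sub>C a *\<^sub>R k p))
    \<le> 2 * C * c * e * measure \<mu> A * norm f *
      norm (toeplitz \<mu> k (\<lambda>x. indicator A x * s x) f - cinner f (k p) *\<^sub>C a *\<^sub>R k p)"
    unfolding d_def .
qed

text \<open>Induction over the cover splits off \<open>A \<inter> U p\<close> and treats it by a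
  rank-one operator. The pieces are disjoint, so their measures add up to that of \<open>A\<close>
  and the error does not grow with the size of the cover.\<close>

lemma toeplitz_indicator_compact_approx:
  assumes s: "bounded_symbol C s" and c: "\<And>x. norm (k x) \<le> c" and "0 \<le> e"
    and "finite F" and U: "\<And>p. p \<in> F \<Longrightarrow> U p \<in> sets \<mu>"
    and Ue: "\<And>p x. p \<in> F \<Longrightarrow> x \<in> U p \<Longrightarrow> norm (k x - k p) \<le> e"
    and "A \<in> sets \<mu>" "emeasure \<mu> A < \<infinity>" "A \<subseteq> (\<Union>p\<in>F. U p)"
  shows "\<exists>S. compact_operator S \<and>
    (\<forall>f. norm (toeplitz \<mu> k (\<lambda>x. indicator A x * s x) f - S f) \<le> 2 * C * c * e * measure \<mu> A * norm f)"
  using assms(4-)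
proof (induction F arbitrary: A rule: finite_induct)
  case empty
  then have "A = {}"
    by simp
  moreover have "toeplitz \<mu> k (\<lambda>x. indicator {} x * s x) f = 0" for f
    by (rule cinner_eqI)
      (subst cinner_toeplitz [OF bounded_symbol_times_indicator [OF s]]; simp add: cinner.zero_left)
  ultimately show ?case
    using compact_operator_zero by (intro exI[of _ "\<lambda>f. 0"]) auto
next
  case (insert p F)
  note [measurable] = \<open>A \<in> sets \<mu>\<close>
  have [measurable]: "U p \<in> sets \<mu>"
    using insert.prems by simp
  have fin: "emeasure \<mu> (A - U p) < \<infinity>" "emeasure \<mu> (A \<inter> U p) < \<infinity>"
    using emeasure_mono [of "A - U p" A \<mu>] emeasure_mono [of "A \<inter> U p" A \<mu>] \<open>emeasure \<mu> A < \<infinity>\<close>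
    by (auto intro: le_less_trans)
  obtain S where S: "compact_operator S" "\<And>f. norm (toeplitz \<mu> k (\<lambda>x. indicator (A - U p) x * s x) f - S f)
      \<le> 2 * C * c * e * measure \<mu> (A - U p) * norm f"
  proof -
    have "A - U p \<in> sets \<mu>"
      by measurable
    moreover have "A - U p \<subseteq> (\<Union>p\<in>F. U p)"
      using insert.prems by auto
    ultimately show thesis
      using insert.IH [of "A - U p"] insert.prems(1,2) fin(1) that by blast
  qed
  define R where "R f = cinner f (k p) *\<^sub>C (\<integral>x. indicator (A \<inter> U p) x * s x \<partial>\<mu>) *\<^sub>R k p" for f
  have R: "norm (toeplitz \<mu> k (\<lambda>x. indicator (A \<inter> U p) x * s x) f - R f)
      \<le> 2 * C * c * e * measure \<mu> (A \<inter> U p) * norm f" for f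
    unfolding R_def using insert.prems fin
    by (intro toeplitz_indicator_rank_one_approx s c \<open>0 \<le> e\<close>) auto
  have "measure \<mu> A = measure \<mu> ((A \<inter> U p) \<union> (A - U p))"
    by (simp add: Int_Diff_Un)
  also have "\<dots> = measure \<mu> (A \<inter> U p) + measure \<mu> (A - U p)"
    using fin by (intro measure_Union) (auto simp: less_top [symmetric])
  finally have measure: "measure \<mu> A = measure \<mu> (A \<inter> U p) + measure \<mu> (A - U p)" .
  have "norm (toeplitz \<mu> k (\<lambda>x. indicator A x * s x) f - (R f + S f))
      \<le> 2 * C * c * e * measure \<mu> A * norm f" for f
  proof -
    have eq: "toeplitz \<mu> k (\<lambda>x. indicator A x * s x) f - (R f + S f) =
      (toeplitz \<mu> k (\<lambda>x. indicator (A \<inter> U p) x * s x) f - R f) +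
      (toeplitz \<mu> k (\<lambda>x. indicator (A - U p) x * s x) f - S f)"
      by (subst toeplitz_split [OF s, of A "U p"]) (auto simp: algebra_simps)
    show ?thesis
      unfolding eq measure distrib_left distrib_right by (rule norm_triangle_mono [OF R S(2)])
  qed
  moreover have "compact_operator R"
    unfolding R_def by (rule compact_operator_rank_one)
  ultimately show ?case
    using compact_operator_add S(1) by blast
qed

text \<open>By continuity of \<open>k\<close>, finitely many open sets on which \<open>k\<close>
  varies by less than \<open>\<epsilon>\<close> cover the compact closure of \<open>A\<close>; then
  \<epsilon> is made arbitrarily small.\<close>

lemma compact_operator_toeplitz_indicator:
  assumes s: "bounded_symbol C s" and c: "\<And>x. norm (k x) \<le> c"
    and [measurable]: "A \<in> sets \<mu>" and fin: "emeasure \<mu> A < \<infinity>" and "compact (closure A)"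
  shows "compact_operator (toeplitz \<mu> k (\<lambda>x. indicator A x * s x))"
proof (rule compact_operator_limit)
  show "Vector_Spaces.linear (*\<^sub>C) (*\<^sub>C) (toeplitz \<mu> k (\<lambda>x. indicator A x * s x))"
    by (rule linear_toeplitz [OF bounded_symbol_times_indicator [OF s]]) simp
  fix e :: real assume "e > 0"
  have "0 \<le> C"
    using s by (auto simp: bounded_symbol_def intro: order_trans)
  have "0 \<le> c"
    using c norm_ge_zero order_trans by blast
  \<comment> \<open>The error constant is \<open>(D - 1) * \<epsilon>\<close>, which is at most
    \<open>D * \<epsilon> = e\<close>; the summand 1 permits division when the constant
    vanishes.\<close>
  define D where "D = 2 * C * c * measure \<mu> A + 1"
  have "D > 0"
    using \<open>0 \<le> C\<close> \<open>0 \<le> c\<close> by (simp add: D_def add_nonneg_pos)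
  define \<epsilon> where "\<epsilon> = e / D"
  have "\<epsilon> > 0"
    using \<open>e > 0\<close> \<open>D > 0\<close> by (simp add: \<epsilon>_def)
  have "D * \<epsilon> = e"
    using \<open>D > 0\<close> by (simp add: \<epsilon>_def)
  define U where "U p = {x. norm (k x - k p) < \<epsilon>}" for p
  have "open (U p)" for p
    unfolding U_def by (intro open_Collect_less continuous_intros continuous_frame)
  moreover have "closure A \<subseteq> (\<Union>p\<in>UNIV. U p)"
  proof
    show "x \<in> (\<Union>p\<in>UNIV. U p)" for x
      using \<open>\<epsilon> > 0\<close> by (auto simp: U_def intro!: exI [of _ x])
  qed
  ultimately obtain F where F: "finite F" "closure A \<subseteq> (\<Union>p\<in>F. U p)"
    using compactE_image [OF \<open>compact (closure A)\<close>, of UNIV U] by metis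
  have "\<exists>S. compact_operator S \<and> (\<forall>f. norm (toeplitz \<mu> k (\<lambda>x. indicator A x * s x) f - S f)
      \<le> 2 * C * c * \<epsilon> * measure \<mu> A * norm f)"
  proof (rule toeplitz_indicator_compact_approx [OF s c _ F(1)])
    show "U p \<in> sets \<mu>" for p
      using \<open>open (U p)\<close> by (simp add: sets_eq)
    show "A \<subseteq> (\<Union>p\<in>F. U p)"
      using F(2) closure_subset by blast
  qed (use \<open>\<epsilon> > 0\<close> fin in \<open>auto simp: U_def\<close>)
  moreover have "2 * C * c * \<epsilon> * measure \<mu> A * norm f \<le> e * norm f" for f :: 'h
  proof -
    have "2 * C * c * \<epsilon> * measure \<mu> A \<le> e"
      using \<open>D * \<epsilon> = e\<close> \<open>\<epsilon> > 0\<close> by (simp add: D_def algebra_simps)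
    then show ?thesis
      by (simp add: mult_right_mono)
  qed
  ultimately show "\<exists>S. compact_operator S \<and>
      (\<forall>f. norm (toeplitz \<mu> k (\<lambda>x. indicator A x * s x) f - S f) \<le> e * norm f)"
    by (meson order_trans)
qed

text \<open>The Schur test bounds \<open>\<parallel>T\<^sub>s f\<parallel>\<^sup>2 \<le> \<Lambda> \<langle>T\<^sub>s f, f\<rangle>\<close>, since the left side is the double integral of
  \<open>s(x) s(y) \<langle>f, k\<^sub>y\<rangle> \<langle>k\<^sub>y, k\<^sub>x\<rangle> \<langle>k\<^sub>x, f\<rangle>\<close> and the right side is \<open>\<Lambda> \<integral>s |\<langle>f, k\<^sub>x\<rangle>|\<^sup>2\<close>.\<close>

lemma norm_toeplitz_le_Schur:
  assumes s: "bounded_symbol C s" and "sigma_finite_measure \<mu>"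
    and K_meas: "(\<lambda>(x, y). K\<^sub>1 x y) \<in> borel_measurable (\<mu> \<Otimes>\<^sub>M \<mu>)"
      "(\<lambda>(x, y). K\<^sub>2 x y) \<in> borel_measurable (\<mu> \<Otimes>\<^sub>M \<mu>)"
    and w_meas: "w\<^sub>1 \<in> borel_measurable \<mu>" "w\<^sub>2 \<in> borel_measurable \<mu>"
    and K\<^sub>1: "\<And>x y. 0 \<le> K\<^sub>1 x y" "\<And>x y. K\<^sub>1 x y = K\<^sub>1 y x" and K\<^sub>2: "\<And>x y. 0 \<le> K\<^sub>2 x y" "\<And>x y. K\<^sub>2 x y = K\<^sub>2 y x"
    and w: "\<And>x. 0 < w\<^sub>1 x" "\<And>x. 0 < w\<^sub>2 x"
    and kernel: "\<And>x y. cmod (cinner (k x) (k y)) = K\<^sub>1 x y + K\<^sub>2 x y"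
    and bound\<^sub>1: "\<And>x. (\<integral>\<^sup>+y. ennreal (s y * (K\<^sub>1 x y * w\<^sub>1 y)) \<partial>\<mu>) \<le> ennreal (\<Lambda>\<^sub>1 * w\<^sub>1 x)" and "0 \<le> \<Lambda>\<^sub>1"
    and bound\<^sub>2: "\<And>x. (\<integral>\<^sup>+y. ennreal (s y * (K\<^sub>2 x y * w\<^sub>2 y)) \<partial>\<mu>) \<le> ennreal (\<Lambda>\<^sub>2 * w\<^sub>2 x)" and "0 \<le> \<Lambda>\<^sub>2"
  shows "norm (toeplitz \<mu> k s f) \<le> (\<Lambda>\<^sub>1 + \<Lambda>\<^sub>2) * norm f"
proof -
  have s_nonneg: "0 \<le> s x" for x
    using s by (simp add: bounded_symbol_def)
  note [measurable] = bounded_symbol_measurable [OF s] K_meas w_meas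
  \<comment> \<open>Absorbing the symbol into the measure leaves the symmetric kernel
    \<open>|\<langle>k x, k y\<rangle>|\<close> for the Schur test. Sigma-finiteness survives
    because \<open>s\<close> is finite.\<close>
  define \<nu> where "\<nu> = density \<mu> (\<lambda>x. ennreal (s x))"
  have sets_\<nu> [measurable_cong]: "sets \<nu> = sets \<mu>"
    by (simp add: \<nu>_def)
  interpret \<nu>: sigma_finite_measure \<nu>
    unfolding \<nu>_def using \<open>sigma_finite_measure \<mu>\<close>
    by (subst sigma_finite_measure.sigma_finite_iff_density_finite) auto
  have nn_integral_\<nu>: "(\<integral>\<^sup>+x. ennreal (g x) \<partial>\<nu>) = (\<integral>\<^sup>+x. ennreal (s x * g x) \<partial>\<mu>)"
    if [measurable]: "g \<in> borel_measurable \<mu>" for g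
    unfolding \<nu>_def by (subst nn_integral_density) (auto simp: ennreal_mult' s_nonneg)
  define u where "u = toeplitz \<mu> k s f"
  define h where "h x = cmod (cinner f (k x))" for x
  have [measurable]: "h \<in> borel_measurable \<mu>"
    unfolding h_def by measurable
  have meas_\<nu>: "w\<^sub>1 \<in> borel_measurable \<nu>" "w\<^sub>2 \<in> borel_measurable \<nu>" "h \<in> borel_measurable \<nu>"
    by measurable
  have "sets (\<nu> \<Otimes>\<^sub>M \<nu>) = sets (\<mu> \<Otimes>\<^sub>M \<mu>)"
    by (intro sets_pair_measure_cong sets_\<nu>)
  then have pair_meas: "(\<lambda>(x, y). K\<^sub>1 x y) \<in> borel_measurable (\<nu> \<Otimes>\<^sub>M \<nu>)"
      "(\<lambda>(x, y). K\<^sub>2 x y) \<in> borel_measurable (\<nu> \<Otimes>\<^sub>M \<nu>)"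
    using K_meas by (simp_all cong: measurable_cong_sets)
  have form: "ennreal (cmod (cinner u g)) \<le> (\<integral>\<^sup>+x. ennreal (h x * cmod (cinner (k x) g)) \<partial>\<nu>)" for g
  proof -
    have "ennreal (cmod (cinner u g)) \<le>
        (\<integral>\<^sup>+x. ennreal (norm (s x *\<^sub>R (cinner f (k x) * cinner (k x) g))) \<partial>\<mu>)"
      unfolding u_def cinner_toeplitz [OF s] by (rule integral_norm_bound_ennreal [OF integrable_form [OF s]])
    also have "\<dots> = (\<integral>\<^sup>+x. ennreal (s x * (h x * cmod (cinner (k x) g))) \<partial>\<mu>)"
      by (simp add: h_def norm_mult s_nonneg)
    also have "\<dots> = (\<integral>\<^sup>+x. ennreal (h x * cmod (cinner (k x) g)) \<partial>\<nu>)"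
      by (rule nn_integral_\<nu> [symmetric]) measurable
    finally show ?thesis .
  qed
  have [measurable]: "K\<^sub>1 x \<in> borel_measurable \<mu>" "K\<^sub>2 x \<in> borel_measurable \<mu>" for x
    using measurable_Pair2 [OF K_meas(1), of x] measurable_Pair2 [OF K_meas(2), of x]
    by (auto simp: sets_eq_imp_space_eq [OF sets_eq])
  \<comment> \<open>The integral of \<open>h\<^sup>2\<close> is the quadratic form of the operator
    at \<open>f\<close>. Bounding it by \<open>norm u * norm f\<close> lets one factor
    \<open>norm u\<close> cancel at the end.\<close>
  have Q: "(\<integral>\<^sup>+x. ennreal ((h x)\<^sup>2) \<partial>\<nu>) \<le> ennreal (norm u * norm f)"
  proof -
    have "(\<integral>\<^sup>+x. ennreal ((h x)\<^sup>2) \<partial>\<nu>) = (\<integral>\<^sup>+x. ennreal (s x * (h x)\<^sup>2) \<partial>\<mu>)"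
      by (rule nn_integral_\<nu>) measurable
    also have "\<dots> = ennreal (\<integral>x. s x * (h x)\<^sup>2 \<partial>\<mu>)"
      using integrable_Re [OF integrable_form [OF s, of f f]]
      by (intro nn_integral_eq_integral) (auto simp: s_nonneg coefficient_square h_def)
    also have "(\<integral>x. s x * (h x)\<^sup>2 \<partial>\<mu>) = Re (cinner u f)"
      using integral_Re [OF integrable_form [OF s, of f f]]
      by (simp add: u_def cinner_toeplitz [OF s] coefficient_square h_def)
    also have "\<dots> \<le> norm u * norm f"
      using complex_Re_le_cmod cinner_Cauchy_Schwarz order_trans by blast
    finally show ?thesis
      by (simp add: ennreal_leI)
  qed
  have "ennreal ((norm u)\<^sup>2) = ennreal (cmod (cinner u u))"
    by (simp add: cinner_self norm_power)
  also have "\<dots> \<le> (\<integral>\<^sup>+x. ennreal (h x * cmod (cinner (k x) u)) \<partial>\<nu>)"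
    by (rule form)
  \<comment> \<open>For fixed \<open>x\<close>, the estimate \<open>form\<close> is applied a second
    time, with \<open>g = k x\<close>, to the factor \<open>cinner (k x) u\<close>. This produces
    the double integral, and the kernel splits into two parts, each with its own Schur
    weight.\<close>
  also have "\<dots> \<le> (\<integral>\<^sup>+x. \<integral>\<^sup>+y. ennreal (K\<^sub>1 x y * h x * h y) + ennreal (K\<^sub>2 x y * h x * h y) \<partial>\<nu> \<partial>\<nu>)"
  proof (rule nn_integral_mono)
    fix x
    have "0 \<le> h x" for x
      by (simp add: h_def)
    have "ennreal (h x * cmod (cinner (k x) u)) = ennreal (h x) * ennreal (cmod (cinner u (k x)))"
      by (simp add: ennreal_mult' h_def cmod_cinner_commute)
    also have "\<dots> \<le> ennreal (h x) * (\<integral>\<^sup>+y. ennreal (h y * cmod (cinner (k y) (k x))) \<partial>\<nu>)"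
      by (intro mult_left_mono form) simp
    also have "\<dots> = (\<integral>\<^sup>+y. ennreal (h x) * ennreal (h y * cmod (cinner (k y) (k x))) \<partial>\<nu>)"
      by (rule nn_integral_cmult [symmetric]) measurable
    also have "\<dots> = (\<integral>\<^sup>+y. ennreal (K\<^sub>1 x y * h x * h y) + ennreal (K\<^sub>2 x y * h x * h y) \<partial>\<nu>)"
      using K\<^sub>1(1) K\<^sub>2(1) \<open>\<And>x. 0 \<le> h x\<close> unfolding kernel K\<^sub>1(2) [of _ x] K\<^sub>2(2) [of _ x]
      by (intro nn_integral_cong)
        (simp add: ennreal_mult' [symmetric] ennreal_plus [symmetric] algebra_simps del: ennreal_plus)
    finally show "ennreal (h x * cmod (cinner (k x) u)) \<le> \<dots>" .
  qed
  also have "\<dots> = (\<integral>\<^sup>+x. \<integral>\<^sup>+y. ennreal (K\<^sub>1 x y * h x * h y) \<partial>\<nu> \<partial>\<nu>)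
      + (\<integral>\<^sup>+x. \<integral>\<^sup>+y. ennreal (K\<^sub>2 x y * h x * h y) \<partial>\<nu> \<partial>\<nu>)"
    by (simp add: nn_integral_add)
  also have "\<dots> \<le> ennreal \<Lambda>\<^sub>1 * (\<integral>\<^sup>+x. ennreal ((h x)\<^sup>2) \<partial>\<nu>) + ennreal \<Lambda>\<^sub>2 * (\<integral>\<^sup>+x. ennreal ((h x)\<^sup>2) \<partial>\<nu>)"
  proof (rule add_mono)
    show "(\<integral>\<^sup>+x. \<integral>\<^sup>+y. ennreal (K\<^sub>1 x y * h x * h y) \<partial>\<nu> \<partial>\<nu>) \<le> ennreal \<Lambda>\<^sub>1 * (\<integral>\<^sup>+x. ennreal ((h x)\<^sup>2) \<partial>\<nu>)"
    proof (rule Schur_test [where w = w\<^sub>1, OF \<nu>.sigma_finite_measure_axioms])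
      show "(\<integral>\<^sup>+y. ennreal (K\<^sub>1 x y * w\<^sub>1 y) \<partial>\<nu>) \<le> ennreal (\<Lambda>\<^sub>1 * w\<^sub>1 x)" for x
        using bound\<^sub>1 by (simp add: nn_integral_\<nu>)
      show "0 \<le> h x" for x
        by (simp add: h_def)
    qed (rule pair_meas meas_\<nu> K\<^sub>1 w \<open>0 \<le> \<Lambda>\<^sub>1\<close>)+
    show "(\<integral>\<^sup>+x. \<integral>\<^sup>+y. ennreal (K\<^sub>2 x y * h x * h y) \<partial>\<nu> \<partial>\<nu>) \<le> ennreal \<Lambda>\<^sub>2 * (\<integral>\<^sup>+x. ennreal ((h x)\<^sup>2) \<partial>\<nu>)"
    proof (rule Schur_test [where w = w\<^sub>2, OF \<nu>.sigma_finite_measure_axioms])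
      show "(\<integral>\<^sup>+y. ennreal (K\<^sub>2 x y * w\<^sub>2 y) \<partial>\<nu>) \<le> ennreal (\<Lambda>\<^sub>2 * w\<^sub>2 x)" for x
        using bound\<^sub>2 by (simp add: nn_integral_\<nu>)
      show "0 \<le> h x" for x
        by (simp add: h_def)
    qed (rule pair_meas meas_\<nu> K\<^sub>2 w \<open>0 \<le> \<Lambda>\<^sub>2\<close>)+
  qed
  also have "\<dots> = ennreal (\<Lambda>\<^sub>1 + \<Lambda>\<^sub>2) * (\<integral>\<^sup>+x. ennreal ((h x)\<^sup>2) \<partial>\<nu>)"
    by (simp only: ennreal_plus [OF \<open>0 \<le> \<Lambda>\<^sub>1\<close> \<open>0 \<le> \<Lambda>\<^sub>2\<close>] distrib_right)
  also have "\<dots> \<le> ennreal (\<Lambda>\<^sub>1 + \<Lambda>\<^sub>2) * ennreal (norm u * norm f)"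
    by (intro mult_left_mono Q) simp
  also have "\<dots> = ennreal ((\<Lambda>\<^sub>1 + \<Lambda>\<^sub>2) * norm f * norm u)"
    using \<open>0 \<le> \<Lambda>\<^sub>1\<close> \<open>0 \<le> \<Lambda>\<^sub>2\<close> by (simp add: ennreal_mult' [symmetric] mult_ac del: ennreal_plus)
  finally have "(norm u)\<^sup>2 \<le> (\<Lambda>\<^sub>1 + \<Lambda>\<^sub>2) * norm f * norm u"
    using \<open>0 \<le> \<Lambda>\<^sub>1\<close> \<open>0 \<le> \<Lambda>\<^sub>2\<close> by (subst (asm) ennreal_le_iff) auto
  then show ?thesis
    unfolding u_def [symmetric] using \<open>0 \<le> \<Lambda>\<^sub>1\<close> \<open>0 \<le> \<Lambda>\<^sub>2\<close>
    by (cases "u = 0") (simp_all add: power2_eq_square)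
qed

end

section \<open>Thin symbols\<close>

context berezin_quantization
begin

sublocale frame: parseval_frame \<mu> k
  by unfold_locales (rule sets_eq_borel parseval)+

abbreviation kernel :: "'x \<Rightarrow> 'x \<Rightarrow> real"
  where "kernel x y \<equiv> cmod (cinner (k x) (k y))"

section \<open>Consequences of homogeneity: uniform constants over the whole space\<close>

lemma transitive:
  obtains g where "g \<in> carrier G" "\<phi> g x = y"
  using unique_orbit by blast

lemma surjective:
  assumes "g \<in> carrier G"
  obtains x where "\<phi> g x = y"
  using surj_prop [OF assms] by (metis UNIV_I imageE)

lemma norm_frame_const: "norm (k x) = norm (k y)"
proof -
  obtain g where "g \<in> carrier G" "\<phi> g x = y"
    by (rule transitive)
  then have "kernel y y = kernel x x"
    using kernel_invariant by blast
  then show ?thesis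
    by (simp add: cinner_self norm_power)
qed

lemma ball_in_sets [measurable]: "ball x r \<in> sets \<mu>"
  by (simp add: sets_eq_borel)

lemma space_eq_UNIV: "space \<mu> = UNIV"
  using sets_eq_imp_space_eq [OF sets_eq_borel] by simp

text \<open>On the diagonal the kernel equals \<open>c\<^sup>2\<close>. Continuity gives a radius
  \<delta> at one point, and the isometric transitive action carries the same \<delta> to all
  points.\<close>

lemma kernel_bounded_below_near_diagonal:
  assumes "c > 0" and c: "\<And>x. norm (k x) = c"
  obtains \<delta> where "\<delta> > 0" "\<And>x y. dist x y < \<delta> \<Longrightarrow> c\<^sup>2 / 2 \<le> kernel x y"
proof -
  let ?x = "undefined :: 'x"
  have "continuous_on UNIV (\<lambda>x. kernel x ?x)"
    by (intro continuous_on_norm cinner.continuous_on continuous_on_const frame.continuous_frame)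
  then have "isCont (\<lambda>x. kernel x ?x) ?x"
    by (simp add: continuous_on_eq_continuous_at)
  moreover have "kernel ?x ?x > c\<^sup>2 / 2"
    using \<open>c > 0\<close> by (simp add: cinner_self c norm_power)
  ultimately have "eventually (\<lambda>x. c\<^sup>2 / 2 < kernel x ?x) (at ?x)"
    by (intro order_tendstoD(1)) (auto simp: isCont_def)
  then obtain \<delta> where \<delta>: "\<delta> > 0" "\<And>x. x \<noteq> ?x \<Longrightarrow> dist x ?x < \<delta> \<Longrightarrow> c\<^sup>2 / 2 < kernel x ?x"
    unfolding eventually_at by auto
  have "c\<^sup>2 / 2 \<le> kernel x y" if "dist x y < \<delta>" for x y
  proof -
    obtain g where g: "g \<in> carrier G" "\<phi> g ?x = y"
      by (rule transitive)
    obtain x' where x': "\<phi> g x' = x"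
      using g(1) by (rule surjective)
    have "dist x' ?x < \<delta>"
      using that dist_invariant [OF g(1), of x' ?x] g(2) x' by simp
    then have "c\<^sup>2 / 2 \<le> kernel x' ?x"
      using \<delta>(2) [of x'] \<open>kernel ?x ?x > c\<^sup>2 / 2\<close> by (cases "x' = ?x") (auto intro: less_imp_le)
    then show ?thesis
      using kernel_invariant [OF g(1), of x' ?x] g(2) x' by simp
  qed
  with \<delta>(1) show thesis
    by (rule that)
qed

text \<open>Properness gives a finite cover of one ball; isometries transport it to every centre, so
  the number of small balls is independent of \<open>y\<close>.\<close>

lemma ball_cover_uniform:
  assumes "\<delta> > 0"
  obtains N where "\<And>y :: 'x. \<exists>P. finite P \<and> card P \<le> N \<and> P \<subseteq> cball y R \<and> ball y R \<subseteq> (\<Union>p\<in>P. ball p \<delta>)"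
proof -
  let ?x = "undefined :: 'x"
  have "closure (ball ?x R) \<subseteq> (\<Union>p\<in>closure (ball ?x R). ball p \<delta>)"
    using assms by force
  then obtain F where F: "F \<subseteq> closure (ball ?x R)" "finite F" "closure (ball ?x R) \<subseteq> (\<Union>p\<in>F. ball p \<delta>)"
    using compactE_image [OF proper, of "closure (ball ?x R)" "\<lambda>p. ball p \<delta>"] by (metis open_ball)
  \<comment> \<open>Keeps the centres in the closed ball about \<open>y\<close>; the next lemma
    bounds the transform only at such points.\<close>
  have "closure (ball ?x R) \<subseteq> cball ?x R"
    by (rule closure_minimal) auto
  show thesis
  proof (rule that [of "card F"])
    fix y
    obtain g where g: "g \<in> carrier G" "\<phi> g ?x = y"
      by (rule transitive)
    note dist = dist_invariant [OF g(1)]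
    have "\<phi> g ` F \<subseteq> cball y R"
      using F(1) \<open>closure (ball ?x R) \<subseteq> cball ?x R\<close> dist [of ?x] g(2) by auto
    moreover have "ball y R \<subseteq> (\<Union>p\<in>\<phi> g ` F. ball p \<delta>)"
    proof
      fix z assume z: "z \<in> ball y R"
      obtain z' where z': "\<phi> g z' = z"
        using g(1) by (rule surjective)
      have "z' \<in> ball ?x R"
        using z dist [of ?x z'] g(2) z' by simp
      then have "z' \<in> (\<Union>p\<in>F. ball p \<delta>)"
        using F(3) closure_subset [of "ball ?x R"] by blast
      then obtain p where "p \<in> F" "dist p z' < \<delta>"
        by auto
      then have "dist (\<phi> g p) z < \<delta>"
        using dist [of p z'] z' by simp
      then show "z \<in> (\<Union>p\<in>\<phi> g ` F. ball p \<delta>)"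
        using \<open>p \<in> F\<close> by auto
    qed
    ultimately show "\<exists>P. finite P \<and> card P \<le> card F \<and> P \<subseteq> cball y R \<and> ball y R \<subseteq> (\<Union>p\<in>P. ball p \<delta>)"
      using F(2) card_image_le [OF F(2)] by (intro exI[of _ "\<phi> g ` F"] conjI finite_imageI)
  qed
qed

text \<open>Converse to averaging: the mass of \<open>s\<close> on a ball is controlled by the
  Berezin transform at nearby points, because the squared kernel is bounded below on each ball of
  radius \<delta>. The constant depends on \<open>R\<close> alone, which is why the symbol, the
  centre and \<eta> are quantified inside the existential.\<close>

lemma nn_integral_ball_le_transform:
  assumes "c > 0" and c: "\<And>x. norm (k x) = c"
  shows "\<exists>A\<ge>0. \<forall>s\<in>borel_measurable \<mu>. \<forall>y. \<forall>\<eta>\<ge>0. (\<forall>x. 0 \<le> s x) \<longrightarrow>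
    (\<forall>p\<in>cball y R. (\<integral>\<^sup>+x. ennreal (s x * (kernel x p)\<^sup>2) \<partial>\<mu>) \<le> ennreal \<eta>) \<longrightarrow>
    (\<integral>\<^sup>+x. ennreal (s x * indicator (ball y R) x) \<partial>\<mu>) \<le> ennreal (A * \<eta>)"
proof -
  obtain \<delta> where \<delta>: "\<delta> > 0" "\<And>x y. dist x y < \<delta> \<Longrightarrow> c\<^sup>2 / 2 \<le> kernel x y"
    by (rule kernel_bounded_below_near_diagonal [OF assms]) (rule that)
  obtain N where N: "\<And>y :: 'x. \<exists>P. finite P \<and> card P \<le> N \<and> P \<subseteq> cball y R \<and> ball y R \<subseteq> (\<Union>p\<in>P. ball p \<delta>)"
    by (rule ball_cover_uniform [OF \<delta>(1)]) (rule that)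
  define a where "a = (c\<^sup>2 / 2)\<^sup>2"
  have "a > 0"
    using \<open>c > 0\<close> by (simp add: a_def)
  \<comment> \<open>\<open>N\<close> counts the small balls and \<open>a\<close> is the lower bound
    of the squared kernel on each of them.\<close>
  show ?thesis
  proof (intro exI[of _ "real N / a"] conjI ballI allI impI)
    fix s :: "'x \<Rightarrow> real" and y and \<eta> :: real
    assume [measurable]: "s \<in> borel_measurable \<mu>" and s: "\<forall>x. 0 \<le> s x" and "0 \<le> \<eta>"
      and bound: "\<forall>p\<in>cball y R. (\<integral>\<^sup>+x. ennreal (s x * (kernel x p)\<^sup>2) \<partial>\<mu>) \<le> ennreal \<eta>"
    obtain P where P: "finite P" "card P \<le> N" "P \<subseteq> cball y R" "ball y R \<subseteq> (\<Union>p\<in>P. ball p \<delta>)"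
      using N [of y] by (elim exE conjE) (rule that)
    have "(\<integral>\<^sup>+x. ennreal (s x * indicator (ball y R) x) \<partial>\<mu>) \<le>
        (\<integral>\<^sup>+x. (\<Sum>p\<in>P. ennreal (1 / a) * ennreal (s x * (kernel x p)\<^sup>2)) \<partial>\<mu>)"
    proof (rule nn_integral_mono)
      fix x
      show "ennreal (s x * indicator (ball y R) x) \<le> (\<Sum>p\<in>P. ennreal (1 / a) * ennreal (s x * (kernel x p)\<^sup>2))"
      proof (cases "x \<in> ball y R")
        case True
        then have "x \<in> (\<Union>p\<in>P. ball p \<delta>)"
          using P(4) by blast
        then obtain p where p: "p \<in> P" "dist x p < \<delta>"
          by (auto simp: dist_commute)
        have "a \<le> (kernel x p)\<^sup>2"
          unfolding a_def using \<delta>(2) [OF p(2)] by (intro power_mono) auto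
        then have "s x * a \<le> s x * (kernel x p)\<^sup>2"
          using s by (intro mult_left_mono) auto
        then have "s x \<le> 1 / a * (s x * (kernel x p)\<^sup>2)"
          using \<open>a > 0\<close> by (simp add: field_simps)
        then have "ennreal (s x) \<le> ennreal (1 / a) * ennreal (s x * (kernel x p)\<^sup>2)"
          using \<open>a > 0\<close> s by (subst ennreal_mult' [symmetric]) (auto intro: ennreal_leI)
        also have "\<dots> \<le> (\<Sum>p\<in>P. ennreal (1 / a) * ennreal (s x * (kernel x p)\<^sup>2))"
          using P(1) p(1) by (intro member_le_sum) auto
        finally show ?thesis
          using True by simp
      qed simp
    qed
    also have "\<dots> = (\<Sum>p\<in>P. ennreal (1 / a) * (\<integral>\<^sup>+x. ennreal (s x * (kernel x p)\<^sup>2) \<partial>\<mu>))"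
      by (simp add: nn_integral_sum nn_integral_cmult)
    also have "\<dots> \<le> (\<Sum>p\<in>P. ennreal (1 / a) * ennreal \<eta>)"
      using P(3) by (intro sum_mono mult_left_mono bound [rule_format]) auto
    also have "\<dots> = ennreal (real (card P) * (1 / a * \<eta>))"
      using \<open>a > 0\<close> \<open>0 \<le> \<eta>\<close> by (simp add: ennreal_mult' [symmetric] ennreal_of_nat_eq_real_of_nat)
    also have "\<dots> \<le> ennreal (real N / a * \<eta>)"
      using P(2) \<open>a > 0\<close> \<open>0 \<le> \<eta>\<close> by (intro ennreal_leI) (simp add: divide_right_mono mult_right_mono)
    finally show "(\<integral>\<^sup>+x. ennreal (s x * indicator (ball y R) x) \<partial>\<mu>) \<le> ennreal (real N / a * \<eta>)" .
  qed (use \<open>a > 0\<close> in simp)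
qed

section \<open>Sigma-finiteness, separability and joint measurability\<close>

text \<open>The previous lemma for the constant symbol 1, whose transform is
  \<open>c\<^sup>2\<close> by Parseval. Finiteness thus comes from the frame; for
  \<open>c = 0\<close> the frame would say nothing about \<mu>.\<close>

lemma emeasure_ball_finite:
  assumes "c > 0" and c: "\<And>x. norm (k x) = c"
  shows "emeasure \<mu> (ball y R) < \<infinity>"
proof -
  obtain A where A: "\<forall>s\<in>borel_measurable \<mu>. \<forall>y. \<forall>\<eta>\<ge>0. (\<forall>x. 0 \<le> s x) \<longrightarrow>
    (\<forall>p\<in>cball y R. (\<integral>\<^sup>+x. ennreal (s x * (kernel x p)\<^sup>2) \<partial>\<mu>) \<le> ennreal \<eta>) \<longrightarrow>
    (\<integral>\<^sup>+x. ennreal (s x * indicator (ball y R) x) \<partial>\<mu>) \<le> ennreal (A * \<eta>)"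
    using nn_integral_ball_le_transform [OF assms, of R] by (elim exE conjE) (rule that)
  have "(\<integral>\<^sup>+x. ennreal ((kernel x p)\<^sup>2) \<partial>\<mu>) = ennreal (c\<^sup>2)" for p
    using frame.nn_integral_coefficient_square [of "k p"] by (simp add: c cmod_cinner_commute [of "k p"])
  then have "(\<integral>\<^sup>+x. ennreal (1 * indicator (ball y R) x) \<partial>\<mu>) \<le> ennreal (A * c\<^sup>2)"
    by (intro A [rule_format]) auto
  then show ?thesis
    by (simp add: ennreal_indicator le_less_trans)
qed

lemma sigma_finite_measure_if_nonzero:
  assumes "c > 0" and c: "\<And>x. norm (k x) = c"
  shows "sigma_finite_measure \<mu>"
proof
  let ?A = "range (\<lambda>n. ball (undefined :: 'x) (real n))"
  have "\<exists>n. dist undefined x < real n" for x :: 'x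
    by (rule reals_Archimedean2)
  then have "\<Union>?A = space \<mu>"
    by (auto simp: space_eq_UNIV)
  moreover have "emeasure \<mu> a \<noteq> \<infinity>" if "a \<in> ?A" for a
    using that emeasure_ball_finite [OF assms] by (auto simp: less_top)
  ultimately show "\<exists>A. countable A \<and> A \<subseteq> sets \<mu> \<and> \<Union>A = space \<mu> \<and> (\<forall>a\<in>A. emeasure \<mu> a \<noteq> \<infinity>)"
    by (intro exI[of _ ?A]) auto
qed

text \<open>Separability from properness: the balls of integer radius exhaust the space and each has
  a finite net.\<close>

lemma countable_net:
  assumes "e > 0"
  shows "\<exists>D::'x set. countable D \<and> (\<forall>x. \<exists>p\<in>D. dist x p < e)"
proof -
  have "\<exists>P. finite P \<and> ball (undefined :: 'x) (real n) \<subseteq> (\<Union>p\<in>P. ball p e)" for n :: nat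
  proof -
    obtain N where "\<And>y :: 'x. \<exists>P. finite P \<and> card P \<le> N \<and> P \<subseteq> cball y (real n) \<and> ball y (real n) \<subseteq> (\<Union>p\<in>P. ball p e)"
      by (rule ball_cover_uniform [OF assms]) (rule that)
    then show ?thesis
      by meson
  qed
  then obtain P where P: "\<And>n::nat. finite (P n)" "\<And>n. ball (undefined :: 'x) (real n) \<subseteq> (\<Union>p\<in>P n. ball p e)"
    by metis
  have "\<exists>p\<in>\<Union>(range P). dist x p < e" for x
  proof -
    obtain n where "dist undefined x < real n"
      using reals_Archimedean2 by blast
    then have "x \<in> ball undefined (real n)"
      by simp
    then have "x \<in> (\<Union>p\<in>P n. ball p e)"
      using P(2) [of n] by blast
    then show ?thesis
      by (auto simp: dist_commute)
  qed
  moreover have "countable (\<Union>(range P))"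
    using P(1) by (simp add: countable_finite)
  ultimately show ?thesis
    by blast
qed

lemma measurable_kernel: "(\<lambda>(x, y). kernel x y) \<in> borel_measurable (\<mu> \<Otimes>\<^sub>M \<mu>)"
  by (rule measurable_pair_if_continuous_fst [OF sets_eq_borel countable_net])
    (auto intro!: continuous_on_norm cinner.continuous_on continuous_on_const frame.continuous_frame)

lemma measurable_dist: "(\<lambda>(x, y). dist x y) \<in> borel_measurable (\<mu> \<Otimes>\<^sub>M \<mu>)"
  by (rule measurable_pair_if_continuous_fst [OF sets_eq_borel countable_net])
    (auto intro!: continuous_intros frame.borel_measurable_if_continuous)

text \<open>Translates between the complex-valued transform in \<open>thin\<close> and the
  nonnegative integrals in the ball estimates; the modulus loses nothing because the integrand is
  nonnegative.\<close>

lemma nn_integral_berezin_transform: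
  assumes s: "frame.bounded_symbol C s"
  shows "(\<integral>\<^sup>+x. ennreal (s x * (kernel x y)\<^sup>2) \<partial>\<mu>) = ennreal (cmod (berezin_transform \<mu> k s y))"
proof -
  have nonneg: "0 \<le> s x" for x
    using s by (simp add: frame.bounded_symbol_def)
  have "integrable \<mu> (\<lambda>x. s x * (kernel x y)\<^sup>2)"
    using integrable_Re [OF frame.integrable_form [OF s, of "k y" "k y"]]
    by (simp add: frame.coefficient_square cmod_cinner_commute [of "k y"])
  moreover have "berezin_transform \<mu> k s y = complex_of_real (\<integral>x. s x * (kernel x y)\<^sup>2 \<partial>\<mu>)"
    unfolding berezin_transform_def frame.cinner_toeplitz [OF s] integral_complex_of_real [symmetric]
    by (simp add: frame.coefficient_square cmod_cinner_commute [of "k y"] scaleR_conv_of_real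
        del: integral_complex_of_real)
  ultimately show ?thesis
    by (simp add: nn_integral_eq_integral nonneg)
qed

section \<open>Compactness implies thinness\<close>

text \<open>Otherwise the transform stays at least \<open>e\<close> in modulus along points tending
  to infinity. Compactness yields a norm limit \<open>l\<close> of the images of their frame vectors
  along a subsequence; weak convergence of these vectors to 0 forces \<open>l = 0\<close>, against
  the lower bound \<open>e\<close>.\<close>

lemma thin_if_compact_operator:
  assumes s: "frame.bounded_symbol C s"
    and decay: "((\<lambda>(x, y). kernel x y) \<longlongrightarrow> 0) (filtercomap (\<lambda>(x, y). dist x y) at_top)"
    and compact: "compact_operator (toeplitz \<mu> k s)"
  shows "thin \<mu> k s"
proof (rule ccontr)
  define z :: 'x where "z = undefined"
  define c where "c = norm (k z)"
  have c: "norm (k x) = c" for x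
    unfolding c_def by (rule norm_frame_const)
  let ?T = "toeplitz \<mu> k s"
  assume "\<not> thin \<mu> k s"
  then have "\<not> (berezin_transform \<mu> k s \<longlongrightarrow> 0) (filtercomap (dist z) at_top)"
    by (simp add: thin_iff [of _ _ _ z])
  then obtain e where "e > 0" and e: "\<And>N. \<exists>y. N \<le> dist z y \<and> e \<le> cmod (berezin_transform \<mu> k s y)"
    by (auto simp: tendsto_iff eventually_filtercomap_at_top_linorder not_less)
  have "\<forall>n. \<exists>y. real n \<le> dist z y \<and> e \<le> cmod (berezin_transform \<mu> k s y)"
    using e by blast
  then obtain y where y: "\<And>n. real n \<le> dist z (y n)" "\<And>n. e \<le> cmod (berezin_transform \<mu> k s (y n))"
    by metis
  have kernel_lim: "(\<lambda>n. kernel x (y n)) \<longlonglongrightarrow> 0" for x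
  proof (rule LIMSEQ_I)
    fix r :: real assume "r > 0"
    then obtain N where N: "\<And>x y. N \<le> dist x y \<Longrightarrow> kernel x y < r"
      using tendstoD [OF decay] by (fastforce simp: eventually_filtercomap_at_top_linorder)
    have "norm (kernel x (y n) - 0) < r" if "nat \<lceil>N + dist z x\<rceil> \<le> n" for n
    proof -
      have "N + dist z x \<le> dist z (y n)"
        using y(1) [of n] that by linarith
      then have "N \<le> dist x (y n)"
        using dist_triangle [of z "y n" x] by linarith
      then show ?thesis
        using N by simp
    qed
    then show "\<exists>no. \<forall>n\<ge>no. norm (kernel x (y n) - 0) < r"
      by blast
  qed
  have weak: "(\<lambda>n. cinner (k (y n)) f) \<longlonglongrightarrow> 0" for f
  proof -
    have "(\<lambda>n. cinner f (k (y n))) \<longlonglongrightarrow> 0"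
      by (rule frame.tendsto_coefficient_zero [OF kernel_lim, of c]) (simp add: c)
    then have "(\<lambda>n. cnj (cinner f (k (y n)))) \<longlonglongrightarrow> cnj 0"
      by (rule tendsto_cnj)
    then show ?thesis
      by (simp add: cinner_commute [of "k _" f])
  qed
  have "compact (closure (?T ` cball 0 c))"
    using compact bounded_cball by (simp add: compact_operator_def)
  moreover have "?T (k (y n)) \<in> closure (?T ` cball 0 c)" for n
    using closure_subset [of "?T ` cball 0 c"] by (auto simp: c)
  ultimately obtain l r where r: "strict_mono r" "((\<lambda>n. ?T (k (y n))) \<circ> r) \<longlonglongrightarrow> l"
    unfolding compact_def by (metis (no_types, lifting))
  have "(\<lambda>n. cinner (?T (k (y (r n)))) l) \<longlonglongrightarrow> cinner l l"
    using r(2) by (intro cinner.tendsto tendsto_const) (simp add: o_def)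
  \<comment> \<open>Self-adjointness moves the operator onto the fixed vector \<open>l\<close>,
    where weak convergence applies; so \<open>cinner l l = 0\<close>.\<close>
  moreover have "(\<lambda>n. cinner (?T (k (y (r n)))) l) \<longlonglongrightarrow> 0"
    using LIMSEQ_subseq_LIMSEQ [OF weak r(1), of "?T l"]
    by (simp add: frame.toeplitz_self_adjoint [OF s] o_def)
  ultimately have "l = 0"
    using LIMSEQ_unique cinner_self_eq_0_iff by blast
  then have "(\<lambda>n. norm (?T (k (y (r n)))) * c) \<longlonglongrightarrow> 0 * c"
    using r(2) by (intro tendsto_mult_right) (simp add: o_def tendsto_norm_zero)
  moreover have "e \<le> norm (?T (k (y (r n)))) * c" for n
    using y(2) [of "r n"] cinner_Cauchy_Schwarz [of "?T (k (y (r n)))" "k (y (r n))"]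
    by (simp add: berezin_transform_def c)
  ultimately have "e \<le> 0 * c"
    by (intro LIMSEQ_le_const) auto
  then show False
    using \<open>e > 0\<close> by simp
qed

section \<open>Thinness implies compactness\<close>

text \<open>Unweighted Schur bound for the kernel near the diagonal, uniform in \<open>x\<close>.
  For \<open>x\<close> far from \<open>z\<close>, thinness makes the mass of \<open>s\<close> on the
  ball about \<open>x\<close> small; for the remaining \<open>x\<close>, the whole ball lies where
  the symbol has been cut off.\<close>

lemma near_kernel_bound:
  assumes "c > 0" and c: "\<And>x. norm (k x) = c" and s: "frame.bounded_symbol C s"
    and "thin \<mu> k s" and "\<epsilon> > 0"
  obtains r where "\<And>x. (\<integral>\<^sup>+y. ennreal (indicator (- ball z r) y * s y * (kernel x y * indicator (ball x R) y)) \<partial>\<mu>) \<le> ennreal \<epsilon>"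
proof -
  have s_nonneg: "0 \<le> s x" for x
    using s by (simp add: frame.bounded_symbol_def)
  note [measurable] = frame.bounded_symbol_measurable [OF s]
  obtain A where "0 \<le> A" and A: "\<forall>s\<in>borel_measurable \<mu>. \<forall>y. \<forall>\<eta>\<ge>0. (\<forall>x. 0 \<le> s x) \<longrightarrow>
    (\<forall>p\<in>cball y R. (\<integral>\<^sup>+x. ennreal (s x * (kernel x p)\<^sup>2) \<partial>\<mu>) \<le> ennreal \<eta>) \<longrightarrow>
    (\<integral>\<^sup>+x. ennreal (s x * indicator (ball y R) x) \<partial>\<mu>) \<le> ennreal (A * \<eta>)"
    using nn_integral_ball_le_transform [OF assms(1,2), of R] by (elim exE conjE) (rule that)
  define \<eta> where "\<eta> = \<epsilon> / (c\<^sup>2 * A + 1)"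
  have "c\<^sup>2 * A + 1 > 0"
    using \<open>0 \<le> A\<close> by (simp add: add_nonneg_pos)
  then have "\<eta> > 0" "c\<^sup>2 * A * \<eta> \<le> \<epsilon>"
    using \<open>\<epsilon> > 0\<close> \<open>0 \<le> A\<close> by (auto simp: \<eta>_def field_simps)
  have "(berezin_transform \<mu> k s \<longlongrightarrow> 0) (filtercomap (dist z) at_top)"
    using \<open>thin \<mu> k s\<close> by (simp add: thin_iff [of _ _ _ z])
  then obtain \<rho> where \<rho>: "\<And>y. \<rho> \<le> dist z y \<Longrightarrow> cmod (berezin_transform \<mu> k s y) < \<eta>"
    using tendstoD [OF _ \<open>\<eta> > 0\<close>] by (fastforce simp: eventually_filtercomap_at_top_linorder)
  \<comment> \<open>One \<open>R\<close> ensures that all points of \<open>cball x R\<close> are at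
    distance at least \<rho> from \<open>z\<close> in the first case; the other ensures that
    \<open>ball x R\<close> lies inside the removed ball in the second.\<close>
  show thesis
  proof (rule that [of "\<rho> + 2 * R"])
    fix x
    let ?r = "\<rho> + 2 * R"
    show "(\<integral>\<^sup>+y. ennreal (indicator (- ball z ?r) y * s y * (kernel x y * indicator (ball x R) y)) \<partial>\<mu>) \<le> ennreal \<epsilon>"
    proof (cases "\<rho> + R \<le> dist z x")
      case True
      have "(\<integral>\<^sup>+y. ennreal (s y * (kernel y p)\<^sup>2) \<partial>\<mu>) \<le> ennreal \<eta>" if "p \<in> cball x R" for p
      proof -
        have "\<rho> \<le> dist z p"
          using True that dist_triangle [of z x p] by (simp add: dist_commute)
        then show ?thesis
          using \<rho> [of p] by (simp add: nn_integral_berezin_transform [OF s] ennreal_leI)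
      qed
      then have *: "(\<integral>\<^sup>+y. ennreal (s y * indicator (ball x R) y) \<partial>\<mu>) \<le> ennreal (A * \<eta>)"
        using \<open>\<eta> > 0\<close> s_nonneg by (intro A [rule_format]) auto
      have "ennreal (indicator (- ball z ?r) y * s y * (kernel x y * indicator (ball x R) y))
          \<le> ennreal (c\<^sup>2) * ennreal (s y * indicator (ball x R) y)" for y
      proof -
        have "kernel x y \<le> c\<^sup>2"
          using cinner_Cauchy_Schwarz [of "k x" "k y"] by (simp add: c power2_eq_square)
        then have "s y * kernel x y \<le> s y * c\<^sup>2"
          using s_nonneg by (rule mult_left_mono)
        then have "indicator (- ball z ?r) y * s y * (kernel x y * indicator (ball x R) y)
          \<le> c\<^sup>2 * (s y * indicator (ball x R) y)"
          using s_nonneg [of y] by (auto simp: indicator_def mult_ac)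
        then show ?thesis
          by (simp add: ennreal_mult' [symmetric] ennreal_leI)
      qed
      then have "(\<integral>\<^sup>+y. ennreal (indicator (- ball z ?r) y * s y * (kernel x y * indicator (ball x R) y)) \<partial>\<mu>)
          \<le> (\<integral>\<^sup>+y. ennreal (c\<^sup>2) * ennreal (s y * indicator (ball x R) y) \<partial>\<mu>)"
        by (intro nn_integral_mono)
      also have "\<dots> = ennreal (c\<^sup>2) * (\<integral>\<^sup>+y. ennreal (s y * indicator (ball x R) y) \<partial>\<mu>)"
        by (rule nn_integral_cmult) measurable
      also have "\<dots> \<le> ennreal (c\<^sup>2) * ennreal (A * \<eta>)"
        by (intro mult_left_mono *) simp
      also have "\<dots> = ennreal (c\<^sup>2 * A * \<eta>)"
        by (simp add: ennreal_mult' [symmetric] mult.assoc)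
      also have "\<dots> \<le> ennreal \<epsilon>"
        by (rule ennreal_leI) fact
      finally show ?thesis .
    next
      case False
      have zero: "indicator (- ball z ?r) y * s y * (kernel x y * indicator (ball x R) y) = 0" for y
        using False dist_triangle [of z y x] by (auto simp: indicator_def)
      show ?thesis
        unfolding zero by simp
    qed
  qed
qed

text \<open>The uniform tail condition on the weighted kernel, multiplied by \<open>w x\<close>; the
  symbol enters only through its bound \<open>C\<close>.\<close>

lemma far_kernel_bound:
  assumes [measurable]: "w \<in> borel_measurable \<mu>" and w: "\<And>x. w x > 0" and s: "frame.bounded_symbol C s"
    and decay: "((\<lambda>R. SUP y. ennreal (inverse (w y)) *
      (\<integral>\<^sup>+x\<in>- ball y R. ennreal (kernel x y * w x) \<partial>\<mu>)) \<longlongrightarrow> 0) at_top"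
    and "\<epsilon> > 0"
  obtains R where "\<And>x. (\<integral>\<^sup>+y. ennreal (s y * (kernel x y * indicator (- ball x R) y * w y)) \<partial>\<mu>) \<le> ennreal (\<epsilon> * w x)"
proof -
  have "0 \<le> C"
    using s by (auto simp: frame.bounded_symbol_def intro: order_trans)
  \<comment> \<open>\<open>C + 1\<close> instead of \<open>C\<close> because \<open>C\<close> may be
    0.\<close>
  define \<eta> where "\<eta> = \<epsilon> / (C + 1)"
  have "\<eta> > 0" "C * \<eta> \<le> \<epsilon>"
    using \<open>\<epsilon> > 0\<close> \<open>0 \<le> C\<close> by (auto simp: \<eta>_def field_simps)
  have "ennreal \<eta> > 0"
    using \<open>\<eta> > 0\<close> by simp
  from order_tendstoD(2) [OF decay this]
  obtain R where R: "(SUP y. ennreal (inverse (w y)) * (\<integral>\<^sup>+x\<in>- ball y R. ennreal (kernel x y * w x) \<partial>\<mu>)) < ennreal \<eta>"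
    by (auto simp: eventually_at_top_linorder)
  show thesis
  proof (rule that [of R])
    fix x
    let ?I = "\<integral>\<^sup>+y. ennreal (kernel y x * w y) * indicator (- ball x R) y \<partial>\<mu>"
    have "ennreal (inverse (w x)) * ?I \<le> ennreal \<eta>"
      using R by (meson SUP_upper UNIV_I less_imp_le order_trans)
    then have "ennreal (w x) * (ennreal (inverse (w x)) * ?I) \<le> ennreal (w x) * ennreal \<eta>"
      by (rule mult_left_mono) simp
    moreover have "ennreal (w x) * ennreal (inverse (w x)) = 1"
      using w [of x] by (simp add: ennreal_mult' [symmetric])
    ultimately have I: "?I \<le> ennreal (w x) * ennreal \<eta>"
      by (simp flip: mult.assoc)
    have "(\<integral>\<^sup>+y. ennreal (s y * (kernel x y * indicator (- ball x R) y * w y)) \<partial>\<mu>) \<le>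
        (\<integral>\<^sup>+y. ennreal C * (ennreal (kernel y x * w y) * indicator (- ball x R) y) \<partial>\<mu>)"
    proof (rule nn_integral_mono)
      fix y
      have "s y * (kernel x y * w y) \<le> C * (kernel x y * w y)"
        using s less_imp_le [OF w] by (intro mult_right_mono) (auto simp: frame.bounded_symbol_def)
      then have "ennreal (s y * (kernel x y * w y)) \<le> ennreal C * ennreal (kernel y x * w y)"
        using \<open>0 \<le> C\<close> by (simp add: ennreal_mult' [symmetric] ennreal_leI cmod_cinner_commute [of "k y" "k x"])
      then show "ennreal (s y * (kernel x y * indicator (- ball x R) y * w y)) \<le>
          ennreal C * (ennreal (kernel y x * w y) * indicator (- ball x R) y)"
        by (auto simp: indicator_def)
    qed
    also have "\<dots> = ennreal C * ?I"
      by (rule nn_integral_cmult) measurable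
    also have "\<dots> \<le> ennreal C * (ennreal (w x) * ennreal \<eta>)"
      by (intro mult_left_mono I) simp
    also have "\<dots> = ennreal (C * \<eta> * w x)"
      using \<open>0 \<le> C\<close> \<open>\<eta> > 0\<close> less_imp_le [OF w] by (simp add: ennreal_mult' [symmetric] mult_ac)
    also have "\<dots> \<le> ennreal (\<epsilon> * w x)"
      using \<open>C * \<eta> \<le> \<epsilon>\<close> less_imp_le [OF w] by (intro ennreal_leI mult_right_mono)
    finally show "(\<integral>\<^sup>+y. ennreal (s y * (kernel x y * indicator (- ball x R) y * w y)) \<partial>\<mu>) \<le> ennreal (\<epsilon> * w x)" .
  qed
qed

text \<open>The weight \<open>w\<close> need not be locally bounded, so it is used only for the part of the kernel far
  from the diagonal; near the diagonal, thinness makes the unweighted Schur test work.\<close>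

lemma compact_operator_if_thin:
  assumes w_meas: "w \<in> borel_measurable \<mu>" and w: "\<And>x. w x > 0" and s: "frame.bounded_symbol C s"
    and decay: "((\<lambda>R. SUP y. ennreal (inverse (w y)) *
      (\<integral>\<^sup>+x\<in>- ball y R. ennreal (kernel x y * w x) \<partial>\<mu>)) \<longlongrightarrow> 0) at_top"
    and "thin \<mu> k s"
  shows "compact_operator (toeplitz \<mu> k s)"
proof -
  define z :: 'x where "z = undefined"
  define c where "c = norm (k z)"
  have c: "norm (k x) = c" for x
    unfolding c_def by (rule norm_frame_const)
  show ?thesis
  proof (cases "c = 0")
    \<comment> \<open>Degenerate case: all frame vectors vanish, so by Parseval the Hilbert space is
      trivial. It is separated because sigma-finiteness was derived only for
      \<open>c > 0\<close>.\<close>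
    case True
    then have "k x = 0" for x
      using c [of x] by simp
    then have "f = 0" for f :: 'h
      by (intro frame.eq_zero_if_orthogonal_frame) (simp add: cinner.zero_right)
    then have "toeplitz \<mu> k s = (\<lambda>f. 0)"
      by blast
    then show ?thesis
      using compact_operator_zero by simp
  next
    case False
    then have "c > 0"
      unfolding c_def by simp
    show ?thesis
    proof (rule compact_operator_limit [OF frame.linear_toeplitz [OF s]])
      fix \<epsilon> :: real assume "\<epsilon> > 0"
      then have "\<epsilon> / 2 > 0"
        by simp
      \<comment> \<open>The order matters: the width \<open>R\<close> of the near part is fixed by
        the far part first, and the cut-off radius \<open>r\<close> depends on it.\<close>
      obtain R where R: "\<And>x. (\<integral>\<^sup>+y. ennreal (s y * (kernel x y * indicator (- ball x R) y * w y)) \<partial>\<mu>)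
          \<le> ennreal (\<epsilon> / 2 * w x)"
        by (rule far_kernel_bound [OF w_meas w s decay \<open>\<epsilon> / 2 > 0\<close>]) (rule that)
      obtain r where r: "\<And>x. (\<integral>\<^sup>+y. ennreal (indicator (- ball z r) y * s y *
          (kernel x y * indicator (ball x R) y)) \<partial>\<mu>) \<le> ennreal (\<epsilon> / 2)"
        by (rule near_kernel_bound [OF \<open>c > 0\<close> c s \<open>thin \<mu> k s\<close> \<open>\<epsilon> / 2 > 0\<close>]) (rule that)
      define K\<^sub>1 where "K\<^sub>1 x y = kernel x y * indicator (ball x R) y" for x y
      define K\<^sub>2 where "K\<^sub>2 x y = kernel x y * indicator (- ball x R) y" for x y
      have K_meas: "(\<lambda>(x, y). K\<^sub>1 x y) \<in> borel_measurable (\<mu> \<Otimes>\<^sub>M \<mu>)" "(\<lambda>(x, y). K\<^sub>2 x y) \<in> borel_measurable (\<mu> \<Otimes>\<^sub>M \<mu>)"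
      proof -
        note [measurable] = measurable_kernel measurable_dist
        have "(\<lambda>(x, y). K\<^sub>1 x y) = (\<lambda>(x, y). if dist x y < R then kernel x y else 0)"
          "(\<lambda>(x, y). K\<^sub>2 x y) = (\<lambda>(x, y). if dist x y < R then 0 else kernel x y)"
          by (auto simp: K\<^sub>1_def K\<^sub>2_def fun_eq_iff indicator_def)
        then show "(\<lambda>(x, y). K\<^sub>1 x y) \<in> borel_measurable (\<mu> \<Otimes>\<^sub>M \<mu>)" "(\<lambda>(x, y). K\<^sub>2 x y) \<in> borel_measurable (\<mu> \<Otimes>\<^sub>M \<mu>)"
          by simp_all measurable
      qed
      define t where "t y = indicator (- ball z r) y * s y" for y
      have t: "frame.bounded_symbol C t"
        unfolding t_def by (intro frame.bounded_symbol_times_indicator s) (simp add: sets_eq_borel)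
      have sym: "K\<^sub>1 x y = K\<^sub>1 y x" "K\<^sub>2 x y = K\<^sub>2 y x" for x y
        by (auto simp: K\<^sub>1_def K\<^sub>2_def indicator_def dist_commute cmod_cinner_commute [of "k x" "k y"])
      have nonneg: "0 \<le> K\<^sub>1 x y" "0 \<le> K\<^sub>2 x y" for x y
        by (auto simp: K\<^sub>1_def K\<^sub>2_def)
      \<comment> \<open>The factors 1 display the constant Schur weight used for the near
        part.\<close>
      have bound\<^sub>1: "(\<integral>\<^sup>+y. ennreal (t y * (K\<^sub>1 x y * 1)) \<partial>\<mu>) \<le> ennreal (\<epsilon> / 2 * 1)" for x
        using r [of x] by (simp add: t_def K\<^sub>1_def)
      have bound\<^sub>2: "(\<integral>\<^sup>+y. ennreal (t y * (K\<^sub>2 x y * w y)) \<partial>\<mu>) \<le> ennreal (\<epsilon> / 2 * w x)" for x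
      proof -
        have "t y * (K\<^sub>2 x y * w y) \<le> s y * (kernel x y * indicator (- ball x R) y * w y)" for y
          unfolding t_def K\<^sub>2_def using s less_imp_le [OF w]
          by (intro mult_right_mono) (auto simp: frame.bounded_symbol_def indicator_def)
        then show ?thesis
          by (intro order_trans [OF nn_integral_mono R] ennreal_leI)
      qed
      have tail: "norm (toeplitz \<mu> k t f) \<le> (\<epsilon> / 2 + \<epsilon> / 2) * norm f" for f
      proof (rule frame.norm_toeplitz_le_Schur [OF t sigma_finite_measure_if_nonzero [OF \<open>c > 0\<close> c]
            K_meas _ w_meas nonneg(1) sym(1) nonneg(2) sym(2) _ w _ bound\<^sub>1 _ bound\<^sub>2])
        show "kernel x y = K\<^sub>1 x y + K\<^sub>2 x y" for x y
          by (auto simp: K\<^sub>1_def K\<^sub>2_def indicator_def)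
      qed (use \<open>\<epsilon> > 0\<close> in auto)
      have "compact_operator (toeplitz \<mu> k (\<lambda>x. indicator (ball z r) x * s x))"
        by (intro frame.compact_operator_toeplitz_indicator [OF s, of c] ball_in_sets proper
            emeasure_ball_finite [OF \<open>c > 0\<close> c]) (simp add: c)
      moreover have "norm (toeplitz \<mu> k s f - toeplitz \<mu> k (\<lambda>x. indicator (ball z r) x * s x) f) \<le> \<epsilon> * norm f" for f
      proof -
        \<comment> \<open>Splitting the whole space at the ball leaves exactly the outer symbol
          \<open>t\<close> as the difference, whose operator \<open>tail\<close> bounds.\<close>
        have "toeplitz \<mu> k s f = toeplitz \<mu> k (\<lambda>x. indicator (ball z r) x * s x) f + toeplitz \<mu> k t f"
          using frame.toeplitz_split [OF s, of UNIV "ball z r" f]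
          unfolding t_def by (simp add: sets_eq_borel Compl_eq_Diff_UNIV)
        then show ?thesis
          using tail [of f] by simp
      qed
      ultimately show "\<exists>S. compact_operator S \<and> (\<forall>f. norm (toeplitz \<mu> k s f - S f) \<le> \<epsilon> * norm f)"
        by blast
    qed
  qed
qed

end

section \<open>The equivalence for essentially bounded symbols\<close>

theorem theorem1:
  fixes G :: "('g, 'm) monoid_scheme" and T :: "'g topology"
    and \<phi> :: "'g \<Rightarrow> 'x::metric_space \<Rightarrow> 'x"
    and \<mu> :: "'x measure" and k :: "'x \<Rightarrow> 'h::chilbert_space"
    and w :: "'x \<Rightarrow> real" and M :: real and \<sigma> :: "'x \<Rightarrow> real"
  assumes "berezin_quantization G T \<phi> \<mu> k"
    and "w \<in> borel_measurable \<mu>" and "\<And>x. w x > 0" and "M > 0"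
    and "\<And>y. ennreal (inverse (w y)) *
      (\<integral>\<^sup>+x. ennreal (cmod (cinner (k x) (k y)) * w x) \<partial>\<mu>) \<le> ennreal M"
    and "((\<lambda>R. SUP y. ennreal (inverse (w y)) *
      (\<integral>\<^sup>+x\<in>- ball y R. ennreal (cmod (cinner (k x) (k y)) * w x) \<partial>\<mu>)) \<longlongrightarrow> 0) at_top"
    and "((\<lambda>(x, y). cmod (cinner (k x) (k y))) \<longlongrightarrow> 0)
      (filtercomap (\<lambda>(x, y). dist x y) at_top)"
    and "\<sigma> \<in> Linfty \<mu>" and "AE x in \<mu>. 0 \<le> \<sigma> x"
  shows "thin \<mu> k \<sigma> \<longleftrightarrow> compact_operator (toeplitz \<mu> k \<sigma>)"
proof -
  interpret berezin_quantization G T \<phi> \<mu> k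
    by fact
  obtain C where [measurable]: "\<sigma> \<in> borel_measurable \<mu>" and C: "AE x in \<mu>. \<bar>\<sigma> x\<bar> \<le> C"
    using \<open>\<sigma> \<in> Linfty \<mu>\<close> by (auto simp: Linfty_def)
  \<comment> \<open>Clipping gives a representative of \<sigma> that is bounded and nonnegative
    everywhere. The inner \<open>max 0 C\<close> guards against a negative \<open>C\<close>, which
    the almost-everywhere bound permits if \<mu> is zero.\<close>
  define s where "s x = max 0 (min (max 0 C) (\<sigma> x))" for x
  have [measurable]: "s \<in> borel_measurable \<mu>"
    unfolding s_def by measurable
  then have s: "frame.bounded_symbol (max 0 C) s"
    by (auto simp: frame.bounded_symbol_def s_def)
  have "AE x in \<mu>. \<sigma> x = s x"
    using C \<open>AE x in \<mu>. 0 \<le> \<sigma> x\<close> by eventually_elim (auto simp: s_def)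
  then have toeplitz: "toeplitz \<mu> k \<sigma> = toeplitz \<mu> k s"
    by (intro frame.toeplitz_cong_AE) measurable
  then have "berezin_transform \<mu> k \<sigma> = berezin_transform \<mu> k s"
    by (simp add: berezin_transform_def fun_eq_iff)
  then have thin: "thin \<mu> k \<sigma> \<longleftrightarrow> thin \<mu> k s"
    by (simp add: thin_def)
  show ?thesis
    unfolding toeplitz thin
    using thin_if_compact_operator [OF s assms(7)] compact_operator_if_thin [OF assms(2,3) s assms(6)]
    by blast
qed

end
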